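(* The class $(\mathfrak{S},\mathfrak{s})$ is a Banach ideal, where $\mathfrak{S}$ is the class of all operators between Banach spaces (over $\mathbb{K}$) with summable Szlenk index and $\mathfrak{s}(A)=\|A\|+\Sigma(A)$.
   Context: The scalar field $\mathbb{K}$ is $\mathbb{R}$ or $\mathbb{C}$; "operator" means bounded linear operator; $B_X$ is the closed unit ball of $X$. Summable Szlenk index: for a weak$^*$-compact $K\subset X^*$ and $\varepsilon>0$, $s_\varepsilon(K)$ denotes the set of those $x^*\in K$ such that $\mathrm{diam}(V\cap K)>\varepsilon$ (norm diameter) for every weak$^*$-neighborhood $V$ of $x^*$; for $\varepsilon\leqslant 0$, $s_\varepsilon(K)=K$. $K$ has $M$-summable Szlenk index ($M\geqslant 0$) if whenever $n\in\mathbb{N}$ and $\varepsilon_1,\ldots,\varepsilon_n\in\mathbb{R}$ are such that $s_{\varepsilon_1}\cdots s_{\varepsilon_n}(K)\neq\varnothing$ (with $s_{\varepsilon_n}$ applied first), then $\sum_{i=1}^n\varepsilon_i\leqslant M$; $K$ has summable Szlenk index if this holds for some $M\geqslant 0$. An operator $A:X\to Y$ has summable Szlenk index if $A^*B_{Y^*}$ does. The quantity $\Sigma$: for a directed set $D$ and $n\in\mathbb{N}$, $D^{\leqslant n}=\bigcup_{i=1}^nD^i$; for $t=(u_i)_{i=1}^k\in D^{\leqslant n}$ and $0\leqslant j\leqslant k$, $t|_j=(u_i)_{i=1}^j$; $(t,u)$ is $t$ with $u$ appended. A collection $(x_t)_{t\in D^{\leqslant n}}\subset X$ is weakly null if for every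 $t\in\{\varnothing\}\cup D^{\leqslant n-1}$, $(x_{(t,u)})_{u\in D}$ is a weakly null net. For an operator $A:X\to Y$, $\Sigma_n(A)$ is the infimum of those $s>0$ such that for every directed set $D$ and every weakly null $(x_t)_{t\in D^{\leqslant n}}\subset B_X$, $\inf_{t\in D^n}\|A\sum_{i=1}^nx_{t|_i}\|\leqslant s$; and $\Sigma(A)=\sup_n\Sigma_n(A)\in[0,\infty]$. Ideals: let $\mathbf{Ban}$ be the class of Banach spaces over $\mathbb{K}$, $\mathfrak{L}$ the class of all operators between Banach spaces, $\mathfrak{L}(X,Y)$ the set of operators from $X$ to $Y$, and for $\mathfrak{I}\subset\mathfrak{L}$ let $\mathfrak{I}(X,Y)=\mathfrak{I}\cap\mathfrak{L}(X,Y)$. A class $\mathfrak{I}\subset \mathfrak{L}$ is an ideal if (i) for any $W,X,Y,Z\in\mathbf{Ban}$, $C\in\mathfrak{L}(W,X)$, $B\in\mathfrak{I}(X,Y)$, $A\in\mathfrak{L}(Y,Z)$, $ABC\in\mathfrak{I}$; (ii) $I_{\mathbb{K}}\in\mathfrak{I}$; (iii) each $\mathfrak{I}(X,Y)$ is a vector subspace of $\mathfrak{L}(X,Y)$. A map $\iota$ assigning to each member of an ideal $\mathfrak{I}$ a non-negative real number is an ideal norm if (i) $\iota$ is a norm on each $\mathfrak{I}(X,Y)$; (ii) for any $C\in\mathfrak{L}(W,X)$, $B\in\mathfrak{I}(X,Y)$, $A\in\mathfrak{L}(Y,Z)$, $\iota(ABC)\leqslant\|A\|\iota(B)\|C\|$;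 (iii) for any $X,Y\in\mathbf{Ban}$, $x^*\in X^*$, $y\in Y$, $\iota(x^*\otimes y)=\|x^*\|\|y\|$, where $x^*\otimes y$ is the operator $x\mapsto x^*(x)y$. $(\mathfrak{I},\iota)$ is a Banach ideal if $\mathfrak{I}$ is an ideal, $\iota$ is an ideal norm on $\mathfrak{I}$, and $(\mathfrak{I}(X,Y),\iota)$ is a Banach space for all $X,Y\in\mathbf{Ban}$. *)

theory Defs
  imports "HOL-Analysis.Analysis"
begin

section \<open>Scalars, spaces and operators\<close>

text \<open>A type of this class is an isometric copy of the field of real numbers or of the field of
  complex numbers, so a type variable of this class ranges over both choices of the scalar field.\<close>

class real_or_complex_field = real_normed_field + banach +
  assumes real_or_complex:
    "(\<exists>\<phi>::'a \<Rightarrow> real. bij \<phi> \<and> (\<forall>x y. \<phi> (x + y) = \<phi> x + \<phi> y) \<and>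
        (\<forall>x y. \<phi> (x * y) = \<phi> x * \<phi> y) \<and> (\<forall>x. norm (\<phi> x) = norm x)) \<or>
     (\<exists>\<phi>::'a \<Rightarrow> complex. bij \<phi> \<and> (\<forall>x y. \<phi> (x + y) = \<phi> x + \<phi> y) \<and>
        (\<forall>x y. \<phi> (x * y) = \<phi> x * \<phi> y) \<and> (\<forall>x. norm (\<phi> x) = norm x))"

instance real :: real_or_complex_field
  by standard (rule disjI1, rule exI[of _ id], simp)

instance complex :: real_or_complex_field
  by standard (rule disjI2, rule exI[of _ id], simp)

text \<open>HOL-Analysis only has real normed spaces as a type class. A normed space over the scalar field
  is a real normed space together with a scalar multiplication that extends the real one; it is a
  Banach space if the carrier type is of class \<open>banach\<close>.\<close>

locale K_normed_space = vector_space scale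
  for scale :: "'k::real_or_complex_field \<Rightarrow> 'x::real_normed_vector \<Rightarrow> 'x" +
  assumes scale_of_real: "scale (of_real r) x = r *\<^sub>R x"
    and norm_scale: "norm (scale c x) = norm c * norm x"

lemma K_normed_space_field: "K_normed_space ((*) :: 'k::real_or_complex_field \<Rightarrow> 'k \<Rightarrow> 'k)"
  by unfold_locales (auto simp: algebra_simps norm_mult scaleR_conv_of_real)

lemma K_normed_space_scaleR: "K_normed_space ((*\<^sub>R) :: real \<Rightarrow> 'x::real_normed_vector \<Rightarrow> 'x)"
  by unfold_locales (auto simp: algebra_simps)

definition operators ::
  "('k::real_or_complex_field \<Rightarrow> 'x::real_normed_vector \<Rightarrow> 'x) \<Rightarrow>
   ('k \<Rightarrow> 'y::real_normed_vector \<Rightarrow> 'y) \<Rightarrow> ('x \<Rightarrow>\<^sub>L 'y) set"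
  where "operators sX sY = {A. Vector_Spaces.linear sX sY (blinfun_apply A)}"

abbreviation dual ::
  "('k::real_or_complex_field \<Rightarrow> 'x::real_normed_vector \<Rightarrow> 'x) \<Rightarrow> ('x \<Rightarrow>\<^sub>L 'k) set"
  where "dual sX \<equiv> operators sX (*)"

definition op_scale ::
  "('k::real_or_complex_field \<Rightarrow> 'y::real_normed_vector \<Rightarrow> 'y) \<Rightarrow> 'k \<Rightarrow>
   ('x::real_normed_vector \<Rightarrow>\<^sub>L 'y) \<Rightarrow> ('x \<Rightarrow>\<^sub>L 'y)"
  where "op_scale sY c A = Blinfun (\<lambda>x. sY c (A x))"

definition rank_one ::
  "('k::real_or_complex_field \<Rightarrow> 'y::real_normed_vector \<Rightarrow> 'y) \<Rightarrow>
   ('x::real_normed_vector \<Rightarrow>\<^sub>L 'k) \<Rightarrow> 'y \<Rightarrow> ('x \<Rightarrow>\<^sub>L 'y)"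
  where "rank_one sY f y = Blinfun (\<lambda>x. sY (f x) y)"

lemma (in K_normed_space) op_scale_apply: "blinfun_apply (op_scale scale c A) x = scale c (A x)"
proof -
  have "bounded_linear (\<lambda>x. scale c (A x))"
  proof (rule bounded_linear_intro[where K = "norm c * norm A"])
    fix x y r
    show "scale c (A (x + y)) = scale c (A x) + scale c (A y)"
      by (simp add: blinfun.add_right scale_right_distrib)
    show "scale c (A (r *\<^sub>R x)) = r *\<^sub>R scale c (A x)"
      by (simp only: blinfun.scaleR_right scale_of_real[symmetric] scale_scale mult.commute)
    show "norm (scale c (A x)) \<le> norm x * (norm c * norm A)"
      using mult_left_mono[OF norm_blinfun[of A x] norm_ge_zero[of c]]
      by (simp add: norm_scale mult_ac)
  qed
  then show ?thesis
    by (simp add: op_scale_def bounded_linear_Blinfun_apply)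
qed

lemma (in K_normed_space) rank_one_apply: "blinfun_apply (rank_one scale f y) x = scale (f x) y"
proof -
  have "bounded_linear (\<lambda>x. scale (f x) y)"
  proof (rule bounded_linear_intro[where K = "norm f * norm y"])
    fix x x' r
    show "scale (f (x + x')) y = scale (f x) y + scale (f x') y"
      by (simp add: blinfun.add_right scale_left_distrib)
    show "scale (f (r *\<^sub>R x)) y = r *\<^sub>R scale (f x) y"
      by (simp only: blinfun.scaleR_right scaleR_conv_of_real[of r "f x"] scale_of_real[symmetric] scale_scale)
    show "norm (scale (f x) y) \<le> norm x * (norm f * norm y)"
      using mult_right_mono[OF norm_blinfun[of f x] norm_ge_zero[of y]]
      by (simp add: norm_scale mult_ac)
  qed
  then show ?thesis
    by (simp add: rank_one_def bounded_linear_Blinfun_apply)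
qed

section \<open>Summable Szlenk index\<close>

text \<open>\<open>strong_operator_topology\<close> is the topology of pointwise convergence, which on functionals is
  the weak* topology.\<close>

definition weak_star ::
  "('k::real_or_complex_field \<Rightarrow> 'x::real_normed_vector \<Rightarrow> 'x) \<Rightarrow> ('x \<Rightarrow>\<^sub>L 'k) topology"
  where "weak_star sX = subtopology strong_operator_topology (dual sX)"

text \<open>These notions are only meant for weak*-compact \<open>K\<close> in the dual of a Banach space. Such a set
  and its subsets are norm bounded, so that \<open>diameter\<close> has its usual meaning on them.\<close>

definition szlenk_deriv ::
  "('k::real_or_complex_field \<Rightarrow> 'x::real_normed_vector \<Rightarrow> 'x) \<Rightarrow> real \<Rightarrow>
   ('x \<Rightarrow>\<^sub>L 'k) set \<Rightarrow> ('x \<Rightarrow>\<^sub>L 'k) set"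
  where "szlenk_deriv sX \<epsilon> K =
    (if \<epsilon> \<le> 0 then K
     else {f \<in> K. \<forall>V. openin (weak_star sX) V \<and> f \<in> V \<longrightarrow> diameter (V \<inter> K) > \<epsilon>})"

text \<open>\<open>foldr\<close> applies the derivation belonging to the last entry of the list first.\<close>

definition summable_Szlenk_const ::
  "('k::real_or_complex_field \<Rightarrow> 'x::real_normed_vector \<Rightarrow> 'x) \<Rightarrow> real \<Rightarrow> ('x \<Rightarrow>\<^sub>L 'k) set \<Rightarrow> bool"
  where "summable_Szlenk_const sX M K \<longleftrightarrow>
    (\<forall>es. es \<noteq> [] \<and> foldr (szlenk_deriv sX) es K \<noteq> {} \<longrightarrow> sum_list es \<le> M)"

definition summable_Szlenk ::
  "('k::real_or_complex_field \<Rightarrow> 'x::real_normed_vector \<Rightarrow> 'x) \<Rightarrow> ('x \<Rightarrow>\<^sub>L 'k) set \<Rightarrow> bool"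
  where "summable_Szlenk sX K \<longleftrightarrow> (\<exists>M\<ge>0. summable_Szlenk_const sX M K)"

definition adjoint_image_ball ::
  "('k::real_or_complex_field \<Rightarrow> 'y::real_normed_vector \<Rightarrow> 'y) \<Rightarrow>
   ('x::real_normed_vector \<Rightarrow>\<^sub>L 'y) \<Rightarrow> ('x \<Rightarrow>\<^sub>L 'k) set"
  where "adjoint_image_ball sY A = (\<lambda>g. g o\<^sub>L A) ` (dual sY \<inter> cball 0 1)"

definition summable_Szlenk_operators ::
  "('k::real_or_complex_field \<Rightarrow> 'x::real_normed_vector \<Rightarrow> 'x) \<Rightarrow>
   ('k \<Rightarrow> 'y::real_normed_vector \<Rightarrow> 'y) \<Rightarrow> ('x \<Rightarrow>\<^sub>L 'y) set"
  where "summable_Szlenk_operators sX sY =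
    {A \<in> operators sX sY. summable_Szlenk sX (adjoint_image_ball sY A)}"

section \<open>Weakly null collections and the quantity \<open>\<Sigma>\<close>\<close>

definition directed_set :: "'d set \<Rightarrow> ('d \<Rightarrow> 'd \<Rightarrow> bool) \<Rightarrow> bool"
  where "directed_set D le \<longleftrightarrow> D \<noteq> {} \<and> (\<forall>u\<in>D. le u u) \<and>
    (\<forall>u\<in>D. \<forall>v\<in>D. \<forall>w\<in>D. le u v \<and> le v w \<longrightarrow> le u w) \<and>
    (\<forall>u\<in>D. \<forall>v\<in>D. \<exists>w\<in>D. le u w \<and> le v w)"

definition net_filter :: "'d set \<Rightarrow> ('d \<Rightarrow> 'd \<Rightarrow> bool) \<Rightarrow> 'd filter"
  where "net_filter D le = (INF u\<in>D. principal {v \<in> D. le u v})"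

lemma eventually_net_filter:
  assumes "directed_set D le"
  shows "eventually P (net_filter D le) \<longleftrightarrow> (\<exists>u\<in>D. \<forall>v\<in>D. le u v \<longrightarrow> P v)"
  unfolding net_filter_def
proof (subst eventually_INF_base)
  show "D \<noteq> {}"
    using assms by (simp add: directed_set_def)
  fix a b assume ab: "a \<in> D" "b \<in> D"
  then obtain w where w: "w \<in> D" "le a w" "le b w"
    using assms unfolding directed_set_def by blast
  have tr: "\<And>u v. u \<in> D \<Longrightarrow> v \<in> D \<Longrightarrow> le u w \<Longrightarrow> le w v \<Longrightarrow> le u v"
    using assms w(1) unfolding directed_set_def by blast
  show "\<exists>x\<in>D. principal {v \<in> D. le x v} \<le> inf (principal {v \<in> D. le a v}) (principal {v \<in> D. le b v})"
    using w ab tr by (intro bexI[of _ w]) auto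
qed (auto simp: eventually_principal)

definition weakly_null_net ::
  "('k::real_or_complex_field \<Rightarrow> 'x::real_normed_vector \<Rightarrow> 'x) \<Rightarrow> 'd set \<Rightarrow> ('d \<Rightarrow> 'd \<Rightarrow> bool) \<Rightarrow>
   ('d \<Rightarrow> 'x) \<Rightarrow> bool"
  where "weakly_null_net sX D le z \<longleftrightarrow>
    (\<forall>f\<in>dual sX. ((\<lambda>u. blinfun_apply f (z u)) \<longlongrightarrow> 0) (net_filter D le))"

text \<open>Tuples are lists: the initial segment \<open>t|\<^sub>i\<close> is \<open>take i t\<close> and \<open>(t, u)\<close> is \<open>t @ [u]\<close>.\<close>

definition weakly_null_collection ::
  "('k::real_or_complex_field \<Rightarrow> 'x::real_normed_vector \<Rightarrow> 'x) \<Rightarrow> 'd set \<Rightarrow> ('d \<Rightarrow> 'd \<Rightarrow> bool) \<Rightarrow>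
   nat \<Rightarrow> ('d list \<Rightarrow> 'x) \<Rightarrow> bool"
  where "weakly_null_collection sX D le n x \<longleftrightarrow>
    (\<forall>t\<in>lists D. length t < n \<longrightarrow> weakly_null_net sX D le (\<lambda>u. x (t @ [u])))"

definition tree_bound ::
  "'d itself \<Rightarrow> ('k::real_or_complex_field \<Rightarrow> 'x::real_normed_vector \<Rightarrow> 'x) \<Rightarrow>
   ('x \<Rightarrow>\<^sub>L 'y::real_normed_vector) \<Rightarrow> nat \<Rightarrow> real \<Rightarrow> bool"
  where "tree_bound ty sX A n s \<longleftrightarrow>
    (\<forall>(D::'d set) le x. directed_set D le \<and> weakly_null_collection sX D le n x \<and>
       (\<forall>t\<in>lists D. 1 \<le> length t \<and> length t \<le> n \<longrightarrow> x t \<in> cball 0 1) \<longrightarrow>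
       (INF t\<in>{t\<in>lists D. length t = n}. norm (A (\<Sum>i=1..n. x (take i t)))) \<le> s)"

text \<open>The infimum is over those \<open>s\<close> that work for every directed set. A definition cannot quantify
  over all types \<open>'d\<close> of indices, but directed sets of sets of vectors suffice: by the theorem
  \<open>tree_bound_any_type\<close> below, a bound that works for these works for directed sets in any type.\<close>

definition Sigma_n ::
  "('k::real_or_complex_field \<Rightarrow> 'x::real_normed_vector \<Rightarrow> 'x) \<Rightarrow>
   ('x \<Rightarrow>\<^sub>L 'y::real_normed_vector) \<Rightarrow> nat \<Rightarrow> real"
  where "Sigma_n sX A n = Inf {s. s > 0 \<and> tree_bound TYPE('x set) sX A n s}"

definition Sigma_op ::
  "('k::real_or_complex_field \<Rightarrow> 'x::real_normed_vector \<Rightarrow> 'x) \<Rightarrow>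
   ('x \<Rightarrow>\<^sub>L 'y::real_normed_vector) \<Rightarrow> ennreal"
  where "Sigma_op sX A = (SUP n\<in>{1..}. ennreal (Sigma_n sX A n))"

definition szlenk_norm ::
  "('k::real_or_complex_field \<Rightarrow> 'x::real_normed_vector \<Rightarrow> 'x) \<Rightarrow>
   ('x \<Rightarrow>\<^sub>L 'y::real_normed_vector) \<Rightarrow> ennreal"
  where "szlenk_norm sX A = ennreal (norm A) + Sigma_op sX A"

theorem tree_bound_any_type:
  fixes sX :: "'k::real_or_complex_field \<Rightarrow> 'x::real_normed_vector \<Rightarrow> 'x"
    and A :: "'x \<Rightarrow>\<^sub>L 'y::real_normed_vector"
  assumes bound: "tree_bound TYPE('x set) sX A n s"
  shows "tree_bound TYPE('d) sX A n s"
  unfolding tree_bound_def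
proof (intro allI impI, elim conjE)
  fix D :: "'d set" and le x
  assume dir: "directed_set D le" and null: "weakly_null_collection sX D le n x"
    and ball: "\<forall>t\<in>lists D. 1 \<le> length t \<and> length t \<le> n \<longrightarrow> x t \<in> cball 0 1"
  define nb where "nb F e = {z. \<forall>f\<in>F. norm (blinfun_apply f z) < e}" for F :: "('x \<Rightarrow>\<^sub>L 'k) set" and e :: real
  define N where "N = {nb F e |F e. finite F \<and> F \<subseteq> dual sX \<and> e > 0}"
  have nbI: "nb F e \<in> N" if "finite F" "F \<subseteq> dual sX" "e > 0" for F e
    unfolding N_def using that by blast
  define le' where "le' U V \<longleftrightarrow> V \<subseteq> U" for U V :: "'x set"
  have dir': "directed_set N le'"
    unfolding directed_set_def
  proof (intro conjI ballI)
    have "nb {} 1 \<in> N" by (rule nbI) auto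
    then show "N \<noteq> {}" by blast
    fix U V assume "U \<in> N" "V \<in> N"
    then obtain F e G d where FG: "U = nb F e" "finite F" "F \<subseteq> dual sX" "e > 0"
      "V = nb G d" "finite G" "G \<subseteq> dual sX" "d > 0" unfolding N_def by blast
    then have "nb (F \<union> G) (min e d) \<in> N"
      by (intro nbI) auto
    moreover have "nb (F \<union> G) (min e d) \<subseteq> U" "nb (F \<union> G) (min e d) \<subseteq> V"
      using FG by (auto simp: nb_def)
    ultimately show "\<exists>W\<in>N. le' U W \<and> le' V W" by (auto simp: le'_def)
  qed (auto simp: le'_def)
  define pick where "pick t U = (SOME u. u \<in> D \<and> (length t < n \<longrightarrow> x (t @ [u]) \<in> U))" for t U
  define \<phi> where "\<phi> T = foldl (\<lambda>t U. t @ [pick t U]) [] T" for T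
  have \<phi>_Nil: "\<phi> [] = []" and \<phi>_snoc: "\<And>T U. \<phi> (T @ [U]) = \<phi> T @ [pick (\<phi> T) U]"
    by (auto simp: \<phi>_def)
  have len: "length (\<phi> T) = length T" for T
    by (induction T rule: rev_induct) (auto simp: \<phi>_Nil \<phi>_snoc)
  have tk: "take i (\<phi> T) = \<phi> (take i T)" for i T
  proof (induction T rule: rev_induct)
    case (snoc U T)
    then show ?case by (cases "i \<le> length T") (auto simp: \<phi>_snoc len)
  qed (simp add: \<phi>_Nil)
  have pick: "pick t U \<in> D \<and> (length t < n \<longrightarrow> x (t @ [pick t U]) \<in> U)"
    if t: "t \<in> lists D" and U: "U \<in> N" for t U
  proof -
    obtain F e where F: "U = nb F e" "finite F" "F \<subseteq> dual sX" "e > 0"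
      using U unfolding N_def by blast
    have "\<exists>u. u \<in> D \<and> (length t < n \<longrightarrow> x (t @ [u]) \<in> U)"
    proof (cases "length t < n")
      case True
      have "eventually (\<lambda>u. norm (blinfun_apply f (x (t @ [u]))) < e) (net_filter D le)" if "f \<in> F" for f
      proof -
        have "((\<lambda>u. blinfun_apply f (x (t @ [u]))) \<longlongrightarrow> 0) (net_filter D le)"
          using null t True F(3) that unfolding weakly_null_collection_def weakly_null_net_def by blast
        from tendstoD[OF this F(4)] show ?thesis by simp
      qed
      then have "eventually (\<lambda>u. \<forall>f\<in>F. norm (blinfun_apply f (x (t @ [u]))) < e) (net_filter D le)"
        using F(2) by (simp add: eventually_ball_finite)
      then obtain u where "u \<in> D" and u: "\<forall>v\<in>D. le u v \<longrightarrow> (\<forall>f\<in>F. norm (blinfun_apply f (x (t @ [v]))) < e)"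
        unfolding eventually_net_filter[OF dir] by blast
      moreover have "le u u" using dir \<open>u \<in> D\<close> by (simp add: directed_set_def)
      ultimately show ?thesis using F(1) by (auto simp: nb_def)
    next
      case False
      moreover have "D \<noteq> {}" using dir unfolding directed_set_def by (rule conjunct1)
      ultimately show ?thesis by blast
    qed
    from someI_ex[OF this] show ?thesis unfolding pick_def .
  qed
  have \<phi>_in: "\<phi> T \<in> lists D" if "T \<in> lists N" for T
    using that
  proof (induction T rule: rev_induct)
    case (snoc U T)
    then have "\<phi> T \<in> lists D" "U \<in> N" by auto
    with pick[of "\<phi> T" U] show ?case by (simp add: \<phi>_snoc)
  qed (simp add: \<phi>_Nil)
  have null': "weakly_null_collection sX N le' n (x \<circ> \<phi>)"
    unfolding weakly_null_collection_def weakly_null_net_def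
  proof (intro ballI impI tendstoI)
    fix T f and e :: real assume T: "T \<in> lists N" "length T < n" and f: "f \<in> dual sX" and "e > 0"
    then have "nb {f} e \<in> N"
      by (intro nbI) auto
    moreover have "dist (blinfun_apply f ((x \<circ> \<phi>) (T @ [V]))) 0 < e" if "V \<in> N" "le' (nb {f} e) V" for V
    proof -
      have "x (\<phi> T @ [pick (\<phi> T) V]) \<in> V"
        using pick[OF \<phi>_in[OF T(1)] that(1)] T(2) by (simp add: len)
      then show ?thesis using that(2) by (auto simp: le'_def nb_def \<phi>_snoc)
    qed
    ultimately show "eventually (\<lambda>U. dist (blinfun_apply f ((x \<circ> \<phi>) (T @ [U]))) 0 < e) (net_filter N le')"
      unfolding eventually_net_filter[OF dir'] by blast
  qed
  have ball': "\<forall>T\<in>lists N. 1 \<le> length T \<and> length T \<le> n \<longrightarrow> (x \<circ> \<phi>) T \<in> cball 0 1"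
    using ball \<phi>_in len by auto
  let ?v = "\<lambda>t. norm (A (\<Sum>i=1..n. x (take i t)))"
  have ne: "{T\<in>lists N. length T = n} \<noteq> {}"
  proof -
    have "N \<noteq> {}" using dir' unfolding directed_set_def by (rule conjunct1)
    then obtain U where "U \<in> N" by blast
    then have "replicate n U \<in> {T\<in>lists N. length T = n}" by (auto simp: in_lists_conv_set)
    then show ?thesis by blast
  qed
  have bdd: "bdd_below (?v ` {t\<in>lists D. length t = n})"
    by (rule bdd_belowI2[where m = 0]) simp
  have "(INF t\<in>{t\<in>lists D. length t = n}. ?v t)
      \<le> (INF T\<in>{T\<in>lists N. length T = n}. norm (A (\<Sum>i=1..n. (x \<circ> \<phi>) (take i T))))"
  proof (rule cINF_greatest[OF ne])
    fix T assume "T \<in> {T\<in>lists N. length T = n}"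
    then have "\<phi> T \<in> {t\<in>lists D. length t = n}" using \<phi>_in len by auto
    from cINF_lower[OF bdd this]
    show "(INF t\<in>{t\<in>lists D. length t = n}. ?v t) \<le> norm (A (\<Sum>i=1..n. (x \<circ> \<phi>) (take i T)))"
      by (simp add: tk)
  qed
  also have "\<dots> \<le> s"
    using bound dir' null' ball' unfolding tree_bound_def by blast
  finally show "(INF t\<in>{t\<in>lists D. length t = n}. ?v t) \<le> s" .
qed

section \<open>Banach ideals\<close>

text \<open>The class of all Banach spaces is the class of all scalar multiplications satisfying
  \<open>K_normed_space\<close> on types of class \<open>banach\<close>. A class of operators is a set \<open>J\<close> of operators for
  each pair of spaces, and a map on it is a function \<open>\<iota>\<close> for each pair of spaces. Since a formula
  cannot quantify over types, the definitions below take the four spaces \<open>W, X, Y, Z\<close> of the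
  axioms as parameters, together with the components of the class and of the map that the axioms
  mention (\<open>JXY\<close>, \<open>JWZ\<close>, and \<open>JKK\<close> for the scalar field). A class is an ideal if its components
  satisfy \<open>operator_ideal\<close> for all choices of the four spaces, that is, if this is a theorem with
  arbitrary spaces on four distinct type variables; likewise for the other two notions.\<close>

definition operator_ideal ::
  "('k::real_or_complex_field \<Rightarrow> 'w::banach \<Rightarrow> 'w) \<Rightarrow> ('k \<Rightarrow> 'x::banach \<Rightarrow> 'x) \<Rightarrow>
   ('k \<Rightarrow> 'y::banach \<Rightarrow> 'y) \<Rightarrow> ('k \<Rightarrow> 'z::banach \<Rightarrow> 'z) \<Rightarrow>
   ('x \<Rightarrow>\<^sub>L 'y) set \<Rightarrow> ('w \<Rightarrow>\<^sub>L 'z) set \<Rightarrow> ('k \<Rightarrow>\<^sub>L 'k) set \<Rightarrow> bool"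
  where "operator_ideal sW sX sY sZ JXY JWZ JKK \<longleftrightarrow>
    JXY \<subseteq> operators sX sY \<and>
    (\<forall>C\<in>operators sW sX. \<forall>B\<in>JXY. \<forall>A\<in>operators sY sZ. A o\<^sub>L B o\<^sub>L C \<in> JWZ) \<and>
    id_blinfun \<in> JKK \<and>
    module.subspace (op_scale sY) JXY"

text \<open>The map is given with values in \<open>[0, \<infinity>]\<close>; that it is a map to the non-negative reals on the
  ideal is the first condition.\<close>

definition ideal_norm ::
  "('k::real_or_complex_field \<Rightarrow> 'w::banach \<Rightarrow> 'w) \<Rightarrow> ('k \<Rightarrow> 'x::banach \<Rightarrow> 'x) \<Rightarrow>
   ('k \<Rightarrow> 'y::banach \<Rightarrow> 'y) \<Rightarrow> ('k \<Rightarrow> 'z::banach \<Rightarrow> 'z) \<Rightarrow>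
   ('x \<Rightarrow>\<^sub>L 'y) set \<Rightarrow> (('x \<Rightarrow>\<^sub>L 'y) \<Rightarrow> ennreal) \<Rightarrow> (('w \<Rightarrow>\<^sub>L 'z) \<Rightarrow> ennreal) \<Rightarrow> bool"
  where "ideal_norm sW sX sY sZ JXY \<iota>XY \<iota>WZ \<longleftrightarrow>
    (\<forall>A\<in>JXY. \<iota>XY A < \<infinity>) \<and>
    (\<forall>A\<in>JXY. \<iota>XY A = 0 \<longleftrightarrow> A = 0) \<and>
    (\<forall>A\<in>JXY. \<forall>B\<in>JXY. \<iota>XY (A + B) \<le> \<iota>XY A + \<iota>XY B) \<and>
    (\<forall>c. \<forall>A\<in>JXY. \<iota>XY (op_scale sY c A) = ennreal (norm c) * \<iota>XY A) \<and>
    (\<forall>C\<in>operators sW sX. \<forall>B\<in>JXY. \<forall>A\<in>operators sY sZ.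
       \<iota>WZ (A o\<^sub>L B o\<^sub>L C) \<le> ennreal (norm A) * \<iota>XY B * ennreal (norm C)) \<and>
    (\<forall>f\<in>dual sX. \<forall>y. \<iota>XY (rank_one sY f y) = ennreal (norm f * norm y))"

definition banach_ideal ::
  "('k::real_or_complex_field \<Rightarrow> 'w::banach \<Rightarrow> 'w) \<Rightarrow> ('k \<Rightarrow> 'x::banach \<Rightarrow> 'x) \<Rightarrow>
   ('k \<Rightarrow> 'y::banach \<Rightarrow> 'y) \<Rightarrow> ('k \<Rightarrow> 'z::banach \<Rightarrow> 'z) \<Rightarrow>
   ('x \<Rightarrow>\<^sub>L 'y) set \<Rightarrow> ('w \<Rightarrow>\<^sub>L 'z) set \<Rightarrow> ('k \<Rightarrow>\<^sub>L 'k) set \<Rightarrow>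
   (('x \<Rightarrow>\<^sub>L 'y) \<Rightarrow> ennreal) \<Rightarrow> (('w \<Rightarrow>\<^sub>L 'z) \<Rightarrow> ennreal) \<Rightarrow> bool"
  where "banach_ideal sW sX sY sZ JXY JWZ JKK \<iota>XY \<iota>WZ \<longleftrightarrow>
    operator_ideal sW sX sY sZ JXY JWZ JKK \<and>
    ideal_norm sW sX sY sZ JXY \<iota>XY \<iota>WZ \<and>
    Metric_space.mcomplete JXY (\<lambda>A B. enn2real (\<iota>XY (A - B)))"

end

theory Submission
  imports Defs
begin

text \<open>Let \<open>w\<close> be the filter of weak neighbourhoods of \<open>0\<close> in the unit ball. Picking the values of a
  weakly null collection one node at a time shows that \<open>\<Sigma>\<^sub>n(A)\<close> is the iterated upper limit of
  \<open>\<parallel>A(x\<^sub>1 + \<dots> + x\<^sub>n)\<parallel>\<close> as \<open>x\<^sub>n, \<dots>, x\<^sub>1\<close> successively tend to \<open>0\<close> along \<open>w\<close>. In this form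
  subadditivity, the ideal inequality and the value on rank one operators are immediate, and
  completeness follows since \<open>\<Sigma>\<^sub>n(A) \<le> n\<parallel>A\<parallel>\<close>.

  It remains to see that \<open>A\<close> has summable Szlenk index iff \<open>\<Sigma>(A) < \<infinity>\<close>. If
  \<open>f \<in> s\<^sub>\<epsilon>(L)\<close>, then weak* close to \<open>f\<close> there is \<open>g \<in> L\<close> with \<open>\<parallel>g - f\<parallel> > \<epsilon>/2\<close>, and
  \<open>Re (g - f)(x)\<close> is almost \<open>\<epsilon>/4\<close> for some weakly small \<open>x\<close> in the ball; iterating gives
  \<open>\<Sum>\<epsilon>\<^sub>i \<le> 4\<Sigma>(A)\<close>. Conversely, take norming functionals of \<open>A(x\<^sub>1 + \<dots> + x\<^sub>n)\<close> and pass to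
  weak* cluster points in \<open>x\<^sub>n, \<dots>, x\<^sub>1\<close> successively. After a pigeonhole argument making the
  contributions \<open>Re f(x\<^sub>i)\<close> nearly constant, each cluster point lies in one more derived set.\<close>

section \<open>Sublinear functionals and the Hahn-Banach theorem\<close>

text \<open>Homogeneity is required only as an inequality for positive factors, which is easy to
  verify for infima; equality is recovered in \<open>sublinear_scaleR\<close>.\<close>

definition sublinear :: "('x::real_vector \<Rightarrow> real) \<Rightarrow> bool"
  where "sublinear p \<longleftrightarrow> (\<forall>x y. p (x + y) \<le> p x + p y) \<and> (\<forall>t>0. \<forall>x. p (t *\<^sub>R x) \<le> t * p x)"

lemma sublinear_add: "sublinear p \<Longrightarrow> p (x + y) \<le> p x + p y"
  by (simp add: sublinear_def)

lemma sublinear_scaleR_le: "sublinear p \<Longrightarrow> 0 < t \<Longrightarrow> p (t *\<^sub>R x) \<le> t * p x"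
  by (simp add: sublinear_def)

text \<open>The factor 2 gives \<open>0 \<le> p 0\<close> and the factor 1/2 gives
  \<open>p 0 \<le> 0\<close>.\<close>

lemma sublinear_zero: "sublinear p \<Longrightarrow> p 0 = 0"
  using sublinear_scaleR_le[of p 2 0] sublinear_scaleR_le[of p "1/2" 0] by simp

lemma sublinear_scaleR:
  assumes "sublinear p" "0 \<le> t"
  shows "p (t *\<^sub>R x) = t * p x"
proof (cases "t = 0")
  case False
  then have t: "0 < t" using assms by simp
  have "p x \<le> inverse t * p (t *\<^sub>R x)"
    using sublinear_scaleR_le[OF assms(1), of "inverse t" "t *\<^sub>R x"] t by simp
  then have "t * p x \<le> p (t *\<^sub>R x)" using t by (simp add: field_simps)
  then show ?thesis using sublinear_scaleR_le[OF assms(1) t, of x] by simp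
qed (simp add: sublinear_zero[OF assms(1)])

lemma sublinear_ge: "sublinear p \<Longrightarrow> - p (- x) \<le> p x"
  using sublinear_add[of p x "- x"] by (simp add: sublinear_zero)

text \<open>Lowering \<open>p\<close> along \<open>a\<close> is the device that makes minimal
  sublinear functionals additive. The infimum is finite because each term is at least
  \<open>- p (- x)\<close>. Parameters \<open>t\<close> for \<open>x\<close> and \<open>s\<close>
  for \<open>y\<close> combine to \<open>t + s\<close> for \<open>x + y\<close>, and scaling by
  \<open>c\<close> replaces \<open>t\<close> by \<open>c * t\<close>.\<close>

lemma sublinear_shift:
  fixes p :: "'x::real_vector \<Rightarrow> real" and a :: 'x
  assumes p: "sublinear p"
  defines "q \<equiv> \<lambda>x. INF t\<in>{0..}. p (x + t *\<^sub>R a) - t * p a"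
  shows "sublinear q" and "q x \<le> p x" and "q x \<le> p (x + a) - p a"
proof -
  have bdd: "bdd_below ((\<lambda>t. p (x + t *\<^sub>R a) - t * p a) ` {0..})" for x
  proof (rule bdd_belowI2[where m = "- p (- x)"])
    fix t :: real assume "t \<in> {0..}"
    then show "- p (- x) \<le> p (x + t *\<^sub>R a) - t * p a"
      using sublinear_add[OF p, of "x + t *\<^sub>R a" "- x"] sublinear_scaleR[OF p, of t a] by simp
  qed
  have le: "q x \<le> p (x + t *\<^sub>R a) - t * p a" if "0 \<le> t" for x t
    unfolding q_def using that by (intro cINF_lower[OF bdd]) simp
  have ge: "c \<le> q x" if "\<And>t. 0 \<le> t \<Longrightarrow> c \<le> p (x + t *\<^sub>R a) - t * p a" for c x
    unfolding q_def by (rule cINF_greatest) (use that in auto)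
  show "q x \<le> p x" using le[of 0 x] by simp
  show "q x \<le> p (x + a) - p a" using le[of 1 x] by simp
  have add: "q (x + y) \<le> q x + q y" for x y
  proof -
    have "q (x + y) - (p (y + s *\<^sub>R a) - s * p a) \<le> q x" if s: "0 \<le> s" for s
    proof (rule ge)
      fix t :: real assume t: "0 \<le> t"
      have "q (x + y) \<le> p (x + y + (t + s) *\<^sub>R a) - (t + s) * p a"
        using s t by (intro le) simp
      also have "p (x + y + (t + s) *\<^sub>R a) \<le> p (x + t *\<^sub>R a) + p (y + s *\<^sub>R a)"
        using sublinear_add[OF p, of "x + t *\<^sub>R a" "y + s *\<^sub>R a"] by (simp add: algebra_simps)
      finally show "q (x + y) - (p (y + s *\<^sub>R a) - s * p a) \<le> p (x + t *\<^sub>R a) - t * p a"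
        by (simp add: algebra_simps)
    qed
    then have "q (x + y) - q x \<le> q y" by (intro ge) (simp add: algebra_simps)
    then show ?thesis by simp
  qed
  have hom: "q (c *\<^sub>R x) \<le> c * q x" if c: "0 < c" for c x
  proof -
    have "q (c *\<^sub>R x) / c \<le> q x"
    proof (rule ge)
      fix t :: real assume t: "0 \<le> t"
      have "q (c *\<^sub>R x) \<le> p (c *\<^sub>R x + (c * t) *\<^sub>R a) - c * t * p a"
        using c t by (intro le) simp
      also have "c *\<^sub>R x + (c * t) *\<^sub>R a = c *\<^sub>R (x + t *\<^sub>R a)" by (simp add: algebra_simps)
      also have "p \<dots> = c * p (x + t *\<^sub>R a)" using c by (intro sublinear_scaleR[OF p]) simp
      finally show "q (c *\<^sub>R x) / c \<le> p (x + t *\<^sub>R a) - t * p a"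
        using c by (simp add: field_simps)
    qed
    then show ?thesis using c by (simp add: field_simps)
  qed
  show "sublinear q" using add hom by (simp add: sublinear_def)
qed

text \<open>Zorn's lemma, a chain being bounded by its pointwise infimum, which is finite since
  every member stays above \<open>- p0 (- x)\<close>.\<close>

lemma minimal_sublinear:
  assumes p0: "sublinear (p0 :: 'x::real_vector \<Rightarrow> real)"
  obtains p where "sublinear p" "p \<le> p0" "\<And>q. sublinear q \<Longrightarrow> q \<le> p \<Longrightarrow> q = p"
proof -
  let ?A = "{p. sublinear p \<and> p \<le> p0}"
  \<comment> \<open>The order is reversed, so that the maximal element supplied by Zorn's lemma is a
    minimal functional.\<close>
  let ?P = "\<lambda>p q :: 'x \<Rightarrow> real. q \<le> p"
  have "\<exists>m\<in>?A. \<forall>a\<in>?A. ?P m a \<longrightarrow> a = m"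
  proof (rule predicate_Zorn)
    show "partial_order_on ?A (relation_of ?P ?A)"
      by (rule partial_order_on_relation_ofI) auto
    fix C assume "C \<in> Chains (relation_of ?P ?A)"
    then have C: "C \<subseteq> ?A" "\<And>p q. p \<in> C \<Longrightarrow> q \<in> C \<Longrightarrow> p \<le> q \<or> q \<le> p"
      by (auto simp: Chains_def relation_of_def)
    show "\<exists>u\<in>?A. \<forall>a\<in>C. ?P a u"
    proof (cases "C = {}")
      case True
      then show ?thesis using p0 by auto
    next
      case False
      define u where "u x = (INF p\<in>C. p x)" for x
      have bdd: "bdd_below ((\<lambda>p. p x) ` C)" for x
      proof (rule bdd_belowI2[where m = "- p0 (- x)"])
        fix p assume "p \<in> C"
        then have "sublinear p" "p (- x) \<le> p0 (- x)" using C(1) by (auto simp: le_fun_def)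
        then show "- p0 (- x) \<le> p x" using sublinear_ge[of p x] by simp
      qed
      have le: "u x \<le> p x" if "p \<in> C" for p x
        unfolding u_def by (rule cINF_lower[OF bdd that])
      have ge: "c \<le> u x" if "\<And>p. p \<in> C \<Longrightarrow> c \<le> p x" for c x
        unfolding u_def by (rule cINF_greatest) (use that False in auto)
      have "u (x + y) \<le> u x + u y" for x y
      proof -
        have "u (x + y) - q y \<le> u x" if q: "q \<in> C" for q
        proof (rule ge)
          fix p assume p: "p \<in> C"
          \<comment> \<open>Members of a chain are comparable, and the smaller of \<open>p\<close>
            and \<open>q\<close> serves for both summands.\<close>
          show "u (x + y) - q y \<le> p x"
          proof (cases "p \<le> q")
            case True
            then have "p y \<le> q y" by (simp add: le_fun_def)
            moreover have "u (x + y) \<le> p x + p y"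
              using le[OF p, of "x + y"] sublinear_add[of p x y] C(1) p by auto
            ultimately show ?thesis by simp
          next
            case False
            then have "q x \<le> p x" using C(2)[OF p q] by (auto simp: le_fun_def)
            moreover have "u (x + y) \<le> q x + q y"
              using le[OF q, of "x + y"] sublinear_add[of q x y] C(1) q by auto
            ultimately show ?thesis by simp
          qed
        qed
        then have "u (x + y) - u x \<le> u y" by (intro ge) (simp add: algebra_simps)
        then show ?thesis by simp
      qed
      moreover have "u (t *\<^sub>R x) \<le> t * u x" if t: "0 < t" for t x
      proof -
        have "u (t *\<^sub>R x) / t \<le> u x"
        proof (rule ge)
          fix p assume p: "p \<in> C"
          then have "u (t *\<^sub>R x) \<le> t * p x"
            using le[OF p, of "t *\<^sub>R x"] sublinear_scaleR_le[of p t x] C(1) t by auto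
          then show "u (t *\<^sub>R x) / t \<le> p x" using t by (simp add: field_simps)
        qed
        then show ?thesis using t by (simp add: field_simps)
      qed
      ultimately have "sublinear u" by (simp add: sublinear_def)
      moreover have "u \<le> p" if "p \<in> C" for p using le[OF that] by (simp add: le_fun_def)
      moreover have "u \<le> p0"
      proof -
        obtain p where "p \<in> C" using False by blast
        then have "u \<le> p" "p \<le> p0" using le C(1) by (auto simp: le_fun_def)
        then show ?thesis by simp
      qed
      ultimately show ?thesis by blast
    qed
  qed
  then obtain p where p: "sublinear p" "p \<le> p0" and min: "\<forall>a\<in>?A. a \<le> p \<longrightarrow> a = p"
    by blast
  have "q = p" if "sublinear q" "q \<le> p" for q
  proof -
    have "q \<le> p0" using that(2) p(2) by (rule order_trans)
    then show ?thesis using min that by blast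
  qed
  with p show thesis by (rule that)
qed

text \<open>Hahn-Banach without extension from subspaces: the norm is shifted along
  \<open>y\<close>, and a minimal sublinear functional below the shift is taken. Shifting it again
  along any \<open>a\<close> cannot lower it, which makes it additive. The first shift forces its
  value at \<open>- y\<close> to be at most \<open>- norm y\<close>.\<close>

lemma real_norming_functional:
  fixes y :: "'y::real_normed_vector"
  obtains g :: "'y \<Rightarrow> real" where "linear g" "\<And>x. g x \<le> norm x" "g y = norm y"
proof -
  have n: "sublinear (norm :: 'y \<Rightarrow> real)"
    by (simp add: sublinear_def norm_triangle_ineq)
  define p0 where "p0 x = (INF t\<in>{0..}. norm (x + t *\<^sub>R y) - t * norm y)" for x
  have p0: "sublinear p0" "\<And>x. p0 x \<le> norm x" "\<And>x. p0 x \<le> norm (x + y) - norm y"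
    using sublinear_shift[OF n, where a = y] unfolding p0_def by auto
  obtain p where p: "sublinear p" "p \<le> p0" and min: "\<And>q. sublinear q \<Longrightarrow> q \<le> p \<Longrightarrow> q = p"
    using minimal_sublinear[OF p0(1)] by blast
  have add: "p (x + a) = p x + p a" for x a
  proof -
    define q where "q x = (INF t\<in>{0..}. p (x + t *\<^sub>R a) - t * p a)" for x
    have q: "sublinear q" "\<And>x. q x \<le> p x" "\<And>x. q x \<le> p (x + a) - p a"
      using sublinear_shift[OF p(1), where a = a] unfolding q_def by auto
    have "q = p" using q by (intro min) (auto simp: le_fun_def)
    then have "p x \<le> p (x + a) - p a" using q(3)[of x] by simp
    then show ?thesis using sublinear_add[OF p(1), of x a] by simp
  qed
  have minus: "p (- x) = - p x" for x
    using add[of x "- x"] sublinear_zero[OF p(1)] by simp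
  have "p (t *\<^sub>R x) = t * p x" for t x
  proof (cases "0 \<le> t")
    case False
    then have "p ((- t) *\<^sub>R x) = - t * p x" by (intro sublinear_scaleR[OF p(1)]) simp
    then show ?thesis using minus[of "t *\<^sub>R x"] by simp
  qed (rule sublinear_scaleR[OF p(1)])
  then have lin: "linear p" by (intro linearI) (auto simp: add)
  have le: "p x \<le> norm x" for x using p(2) p0(2)[of x] by (auto simp: le_fun_def intro: order_trans)
  have "p (- y) \<le> - norm y" using p(2) p0(3)[of "- y"] by (auto simp: le_fun_def intro: order_trans)
  then have "p y = norm y" using minus[of y] le[of y] by simp
  with lin le show thesis by (rule that)
qed

section \<open>Scalars and functionals\<close>

text \<open>The image of 1 is a nonzero idempotent, hence 1. The image of \<open>t\<close> then has
  distances \<open>\<bar>t\<bar>\<close> from 0 and \<open>\<bar>t - 1\<bar>\<close> from 1, and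
  \<open>t\<close> is the only complex number with both.\<close>

lemma isometric_real_embedding:
  fixes \<psi> :: "'k::real_normed_field \<Rightarrow> complex"
  assumes add: "\<And>x y. \<psi> (x + y) = \<psi> x + \<psi> y" and mult: "\<And>x y. \<psi> (x * y) = \<psi> x * \<psi> y"
    and iso: "\<And>x. norm (\<psi> x) = norm x"
  shows "\<psi> (of_real t) = of_real t"
proof -
  have "\<psi> 1 * \<psi> 1 = \<psi> 1" using mult[of 1 1] by simp
  moreover have "\<psi> 1 \<noteq> 0" using iso[of 1] by auto
  ultimately have one: "\<psi> 1 = 1" by simp
  let ?z = "\<psi> (of_real t)"
  have "\<psi> (of_real t - 1) = ?z - 1"
    using add[of "of_real t - 1" 1] one by simp
  then have "norm (?z - 1) = \<bar>t - 1\<bar>"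
    using iso[of "of_real t - 1"] by (metis norm_of_real of_real_1 of_real_diff)
  then have "(norm (?z - 1))\<^sup>2 = (t - 1)\<^sup>2" by simp
  moreover have "(norm ?z)\<^sup>2 = t\<^sup>2" using iso[of "of_real t"] by simp
  ultimately have "(Re ?z)\<^sup>2 + (Im ?z)\<^sup>2 = t\<^sup>2" "(Re ?z - 1)\<^sup>2 + (Im ?z)\<^sup>2 = (t - 1)\<^sup>2"
    by (simp_all add: cmod_power2)
  then have "Re ?z = t" "Im ?z = 0" by (auto simp: power2_eq_square algebra_simps)
  then show ?thesis by (simp add: complex_eq_iff)
qed

text \<open>\<open>j\<close> is an imaginary unit in the complex case and \<open>0\<close> in the real case.\<close>

lemma scalar_real_part_exists:
  "\<exists>r :: 'k::real_or_complex_field \<Rightarrow> real. \<exists>j. linear r \<and> (\<forall>c. \<bar>r c\<bar> \<le> norm c) \<and> r 1 = 1 \<and>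
     (j = 0 \<or> j * j = - 1) \<and> (\<forall>c. c = of_real (r c) - j * of_real (r (j * c)))"
proof -
  have *: ?thesis
    if add: "\<And>x y. \<psi> (x + y) = \<psi> x + \<psi> y" and mult: "\<And>x y. \<psi> (x * y) = \<psi> x * \<psi> y"
      and iso: "\<And>x. norm (\<psi> x) = norm x"
      and alt: "(\<forall>x. Im (\<psi> x) = 0) \<or> (\<exists>j. \<psi> j = \<i>)" for \<psi> :: "'k \<Rightarrow> complex"
  proof -
    note of_real = isometric_real_embedding[of \<psi>, OF add mult iso]
    have minus: "\<psi> (x - y) = \<psi> x - \<psi> y" for x y using add[of "x - y" y] by simp
    have inj: "x = y" if "\<psi> x = \<psi> y" for x y
      using iso[of "x - y"] that by (simp add: minus)
    define r where "r c = Re (\<psi> c)" for c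
    have "linear r"
      by (rule linearI) (simp_all add: r_def add mult of_real scaleR_conv_of_real)
    moreover have "\<bar>r c\<bar> \<le> norm c" for c
      using abs_Re_le_cmod[of "\<psi> c"] by (simp add: r_def iso)
    moreover have "r 1 = 1" using of_real[of 1] by (simp add: r_def)
    moreover have "\<exists>j. (j = 0 \<or> j * j = - 1) \<and> (\<forall>c. c = of_real (r c) - j * of_real (r (j * c)))"
    proof (cases "\<forall>x. Im (\<psi> x) = 0")
      case True
      have "c = of_real (r c)" for c
        by (rule inj) (simp add: of_real r_def complex_eq_iff True)
      then show ?thesis by (intro exI[of _ 0]) simp
    next
      case False
      then obtain j where j: "\<psi> j = \<i>" using alt by blast
      have "j * j = - 1"
        by (rule inj) (use minus[of 0 1] of_real[of 0] of_real[of 1] in \<open>simp add: mult j\<close>)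
      moreover have "c = of_real (r c) - j * of_real (r (j * c))" for c
        by (rule inj) (simp add: minus add mult of_real r_def complex_eq_iff j)
      ultimately show ?thesis by blast
    qed
    ultimately show ?thesis by blast
  qed
  from real_or_complex[where 'a='k] show ?thesis
  proof (elim disjE exE conjE)
    fix \<phi> :: "'k \<Rightarrow> real"
    assume "bij \<phi>" "\<forall>x y. \<phi> (x + y) = \<phi> x + \<phi> y" "\<forall>x y. \<phi> (x * y) = \<phi> x * \<phi> y"
      "\<forall>x. norm (\<phi> x) = norm x"
    then show ?thesis by (intro *[of "\<lambda>x. of_real (\<phi> x)"]) auto
  next
    fix \<phi> :: "'k \<Rightarrow> complex"
    assume "bij \<phi>" and \<phi>: "\<forall>x y. \<phi> (x + y) = \<phi> x + \<phi> y" "\<forall>x y. \<phi> (x * y) = \<phi> x * \<phi> y"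
      "\<forall>x. norm (\<phi> x) = norm x"
    then obtain j where "\<phi> j = \<i>" by (metis bij_pointE)
    with \<phi> show ?thesis by (intro *[of \<phi>]) auto
  qed
qed

text \<open>A real part for both scalar fields. It is picked by \<open>SOME\<close> because the
  class only asserts that an isomorphism exists, without naming one.\<close>

definition scalar_Re :: "'k::real_or_complex_field \<Rightarrow> real"
  where "scalar_Re = (SOME r. \<exists>j. linear r \<and> (\<forall>c. \<bar>r c\<bar> \<le> norm c) \<and> r 1 = 1 \<and>
     (j = 0 \<or> j * j = - 1) \<and> (\<forall>c. c = of_real (r c) - j * of_real (r (j * c))))"

lemma scalar_Re_decomposition:
  obtains j :: "'k::real_or_complex_field"
  where "j = 0 \<or> j * j = - 1"
    "\<And>c :: 'k. c = of_real (scalar_Re c) - j * of_real (scalar_Re (j * c))"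
  using someI_ex[OF scalar_real_part_exists[where 'k='k], folded scalar_Re_def] by blast

lemma linear_scalar_Re: "linear (scalar_Re :: 'k::real_or_complex_field \<Rightarrow> real)"
  and abs_scalar_Re_le: "\<bar>scalar_Re c\<bar> \<le> norm (c :: 'k)"
  and scalar_Re_one [simp]: "scalar_Re (1 :: 'k) = 1"
  using someI_ex[OF scalar_real_part_exists[where 'k='k], folded scalar_Re_def] by blast+

lemma scalar_Re_le: "scalar_Re c \<le> norm (c :: 'k::real_or_complex_field)"
  using abs_scalar_Re_le[of c] by simp

lemma scalar_Re_add: "scalar_Re (a + b) = scalar_Re a + scalar_Re b"
  and scalar_Re_diff: "scalar_Re (a - b) = scalar_Re a - scalar_Re b"
  and scalar_Re_scaleR: "scalar_Re (t *\<^sub>R a) = t * scalar_Re (a :: 'k::real_or_complex_field)"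
  using linear_add[OF linear_scalar_Re] linear_diff[OF linear_scalar_Re]
    linear_cmul[OF linear_scalar_Re] by auto

lemma scalar_Re_of_real: "scalar_Re (of_real t :: 'k::real_or_complex_field) = t"
  using scalar_Re_scaleR[of t "1 :: 'k"] by (simp add: scaleR_conv_of_real)

lemma scalar_phase:
  fixes c :: "'k::real_or_complex_field"
  obtains u :: 'k where "norm u = 1" "u * c = of_real (norm c)"
proof (cases "c = 0")
  case True
  then show thesis by (intro that[of 1]) simp_all
next
  case False
  then show thesis by (intro that[of "of_real (norm c) / c"]) (simp_all add: norm_divide)
qed

text \<open>The decomposition of scalars exhibits the ball as a closed subset of the continuous
  image of a square; \<open>norm j \<le> 1\<close> keeps both coordinates in range.\<close>

lemma compact_cball_scalar: "compact (cball (0 :: 'k::real_or_complex_field) R)"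
proof -
  obtain j :: 'k where j: "j = 0 \<or> j * j = - 1"
    and dec: "\<And>c :: 'k. c = of_real (scalar_Re c) - j * of_real (scalar_Re (j * c))"
    using scalar_Re_decomposition by blast
  have nj: "norm j \<le> 1"
  proof (cases "j = 0")
    case False
    then have "norm j * norm j = 1" using j by (metis norm_minus_cancel norm_mult norm_one)
    then have "norm j = 1" by (metis abs_of_nonneg norm_ge_zero real_sqrt_abs2 real_sqrt_one)
    then show ?thesis by simp
  qed simp
  let ?h = "\<lambda>p. of_real (fst p) - j * of_real (snd p)"
  have "compact (?h ` ({- R..R} \<times> {- R..R}))"
    by (intro compact_continuous_image continuous_intros compact_Times compact_Icc)
  moreover have "cball 0 R \<subseteq> ?h ` ({- R..R} \<times> {- R..R})"
  proof
    fix c :: 'k assume "c \<in> cball 0 R"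
    then have c: "norm c \<le> R" by simp
    have "\<bar>scalar_Re (j * c)\<bar> \<le> norm j * norm c"
      using abs_scalar_Re_le[of "j * c"] by (simp add: norm_mult)
    also have "\<dots> \<le> 1 * norm c" by (rule mult_right_mono[OF nj]) simp
    finally have "(scalar_Re c, scalar_Re (j * c)) \<in> {- R..R} \<times> {- R..R}"
      using c abs_scalar_Re_le[of c] by auto
    moreover have "c = ?h (scalar_Re c, scalar_Re (j * c))" using dec[of c] by simp
    ultimately show "c \<in> ?h ` ({- R..R} \<times> {- R..R})" by (rule rev_image_eqI)
  qed
  ultimately show ?thesis
    by (metis closed_cball compact_Int_closed inf.absorb_iff2)
qed

lemma operators_iff:
  assumes "K_normed_space sX" "K_normed_space sY"
  shows "A \<in> operators sX sY \<longleftrightarrow> (\<forall>c x. blinfun_apply A (sX c x) = sY c (A x))"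
  using assms by (auto simp: operators_def K_normed_space_def Vector_Spaces.linear_iff blinfun.add_right)

lemma dual_iff:
  assumes "K_normed_space sX"
  shows "f \<in> dual sX \<longleftrightarrow> (\<forall>c x. blinfun_apply f (sX c x) = c * f x)"
  by (rule operators_iff[OF assms K_normed_space_field])

text \<open>The real functional \<open>h\<close> norming \<open>y\<close> is turned into a scalar
  one by the classical formula \<open>G x = h x - j h(j x)\<close>, whose real part is
  \<open>h\<close>. Its norm does not grow, since \<open>u * G x\<close> is real for a suitable
  unimodular \<open>u\<close> and thus equals \<open>h(u x)\<close>.\<close>

lemma norming_functional:
  fixes sY :: "'k::real_or_complex_field \<Rightarrow> 'y::real_normed_vector \<Rightarrow> 'y"
  assumes "K_normed_space sY"
  obtains g where "g \<in> dual sY" "norm g \<le> 1" "scalar_Re (blinfun_apply g y) = norm y"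
proof -
  interpret Y: K_normed_space sY by fact
  obtain h :: "'y \<Rightarrow> real" where lin: "linear h" and le: "\<And>x. h x \<le> norm x" and hy: "h y = norm y"
    using real_norming_functional by blast
  obtain j :: 'k where j: "j = 0 \<or> j * j = - 1"
    and dec: "\<And>c :: 'k. c = of_real (scalar_Re c) - j * of_real (scalar_Re (j * c))"
    using scalar_Re_decomposition by blast
  define G where "G x = of_real (h x) - j * of_real (h (sY j x))" for x
  have h_real: "h (sY (of_real t) x) = t * h x" for t x
    using linear_cmul[OF lin, of t x] by (simp add: Y.scale_of_real)
  have add: "G (x + x') = G x + G x'" for x x'
    by (simp add: G_def Y.scale_right_distrib linear_add[OF lin] distrib_left)
  have real: "G (sY (of_real t) x) = of_real t * G x" for t x
    by (simp only: G_def Y.scale_left_commute[of j] h_real of_real_mult right_diff_distrib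
        mult.left_commute[of j])
  have imag: "G (sY j x) = j * G x" for x
    using j
  proof
    assume "j = 0"
    then show ?thesis using linear_0[OF lin] by (simp add: G_def)
  next
    assume jj: "j * j = - 1"
    have "h (- x) = - h x" using linear_neg[OF lin] .
    then have "G (sY j x) = of_real (h (sY j x)) - j * of_real (- h x)"
      by (simp add: G_def jj)
    also have "\<dots> = j * of_real (h x) - (j * j) * of_real (h (sY j x))"
      by (simp add: jj)
    also have "\<dots> = j * G x" by (simp only: G_def right_diff_distrib mult.assoc)
    finally show ?thesis .
  qed
  have hom: "G (sY c x) = c * G x" for c x
  proof -
    define a b where "a = scalar_Re c" and "b = scalar_Re (j * c)"
    have c: "c = of_real a + of_real (- b) * j" using dec[of c] by (simp add: a_def b_def mult.commute)
    have "G (sY c x) = of_real a * G x + of_real (- b) * (j * G x)"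
      unfolding c Y.scale_left_distrib add real Y.scale_scale[symmetric] imag ..
    then show ?thesis by (subst c) (simp add: algebra_simps)
  qed
  have Re: "scalar_Re (G x) = h x" for x
  proof -
    \<comment> \<open>The decomposition of the real scalar \<open>t\<close> reads
      \<open>t = t - j Re(j t)\<close>, so \<open>j\<close> or \<open>Re(j t)\<close>
      vanishes.\<close>
    have "j = 0 \<or> scalar_Re (j * of_real t) = 0" for t
      using dec[of "of_real t"] by (auto simp: scalar_Re_of_real)
    then have "scalar_Re (j * of_real (h (sY j x))) = 0"
      using scalar_Re_of_real[of 0, where 'k='k] by (metis mult_zero_left of_real_0)
    then show ?thesis by (simp add: G_def scalar_Re_diff scalar_Re_of_real)
  qed
  have norm: "norm (G x) \<le> norm x" for x
  proof -
    obtain u :: 'k where u: "norm u = 1" "u * G x = of_real (norm (G x))"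
      using scalar_phase by blast
    have "norm (G x) = h (sY u x)"
      using arg_cong[OF u(2), of scalar_Re] by (simp add: scalar_Re_of_real hom[symmetric] Re)
    also have "\<dots> \<le> norm (sY u x)" by (rule le)
    also have "\<dots> = norm x" by (simp add: Y.norm_scale u(1))
    finally show ?thesis .
  qed
  have "bounded_linear G"
  proof (rule bounded_linear_intro[where K = 1])
    show "G (t *\<^sub>R x) = t *\<^sub>R G x" for t x
      using real[of t x] by (simp add: Y.scale_of_real scaleR_conv_of_real)
  qed (use add norm in auto)
  then have app: "blinfun_apply (Blinfun G) = G" by (rule bounded_linear_Blinfun_apply)
  show thesis
  proof
    show "Blinfun G \<in> dual sY" by (simp add: dual_iff[OF assms] app hom)
    show "norm (Blinfun G) \<le> 1" by (rule norm_blinfun_bound) (use norm in \<open>auto simp: app\<close>)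
    show "scalar_Re (Blinfun G y) = norm y" by (simp add: app Re hy)
  qed
qed

lemma Re_norming_vector:
  fixes sX :: "'k::real_or_complex_field \<Rightarrow> 'x::real_normed_vector \<Rightarrow> 'x"
  assumes X: "K_normed_space sX" and h: "h \<in> dual sX" and e: "0 \<le> e" "e < norm h"
  obtains x where "norm x \<le> 1" "e < scalar_Re (blinfun_apply h x)"
proof -
  interpret X: K_normed_space sX by fact
  obtain z where z: "e * norm z < norm (h z)"
    using norm_blinfun_bound[OF e(1), of h] e(2) by (meson not_le)
  then have "z \<noteq> 0" by auto
  define z' where "z' = (1 / norm z) *\<^sub>R z"
  have z': "norm z' = 1" "e < norm (h z')"
    using z \<open>z \<noteq> 0\<close> by (simp_all add: z'_def blinfun.scaleR_right field_simps)
  obtain u :: 'k where u: "norm u = 1" "u * h z' = of_real (norm (h z'))"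
    using scalar_phase by blast
  show thesis
  proof
    show "norm (sX u z') \<le> 1" by (simp add: X.norm_scale u z')
    show "e < scalar_Re (h (sX u z'))" using h z' by (simp add: dual_iff[OF X] u scalar_Re_of_real)
  qed
qed

section \<open>Iterated bounds along the weakly null filter\<close>

text \<open>This is the trace on the closed unit ball of the weak neighbourhoods of 0. Every weakly
  null net in the ball finally enters each set of the base, so this single filter stands in for all
  directed sets.\<close>

definition weakly_null_filter ::
  "('k::real_or_complex_field \<Rightarrow> 'x::real_normed_vector \<Rightarrow> 'x) \<Rightarrow> 'x filter"
  where "weakly_null_filter sX =
    (INF (F, e)\<in>{(F, e). finite F \<and> F \<subseteq> dual sX \<and> 0 < e}.
      principal {x. norm x \<le> 1 \<and> (\<forall>f\<in>F. norm (blinfun_apply f x) < e)})"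

lemma eventually_weakly_null_filter:
  "eventually P (weakly_null_filter sX) \<longleftrightarrow>
    (\<exists>F e. finite F \<and> F \<subseteq> dual sX \<and> 0 < e \<and>
      (\<forall>x. norm x \<le> 1 \<and> (\<forall>f\<in>F. norm (blinfun_apply f x) < e) \<longrightarrow> P x))"
  unfolding weakly_null_filter_def
proof (subst eventually_INF_base)
  let ?I = "{(F, e). finite F \<and> F \<subseteq> dual sX \<and> (0::real) < e}"
  have "({}, 1) \<in> ?I" by simp
  then show "?I \<noteq> {}" by blast
  fix p q assume "p \<in> ?I" "q \<in> ?I"
  then have "(fst p \<union> fst q, min (snd p) (snd q)) \<in> ?I" by auto
  then show "\<exists>r\<in>?I. (case r of (F, e) \<Rightarrow> principal {x. norm x \<le> 1 \<and> (\<forall>f\<in>F. norm (blinfun_apply f x) < e)})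
      \<le> inf (case p of (F, e) \<Rightarrow> principal {x. norm x \<le> 1 \<and> (\<forall>f\<in>F. norm (blinfun_apply f x) < e)})
          (case q of (F, e) \<Rightarrow> principal {x. norm x \<le> 1 \<and> (\<forall>f\<in>F. norm (blinfun_apply f x) < e)})"
    by (rule bexI[rotated]) (auto split: prod.split)
qed (auto simp: eventually_principal)

lemma eventually_weakly_null_filterE:
  assumes "eventually P (weakly_null_filter sX)"
  obtains F e where "finite F" "F \<subseteq> dual sX" "0 < e"
    "\<And>x. norm x \<le> 1 \<Longrightarrow> (\<And>f. f \<in> F \<Longrightarrow> norm (blinfun_apply f x) < e) \<Longrightarrow> P x"
proof -
  obtain F e where F: "finite F" "F \<subseteq> dual sX" "0 < e"
    and P: "\<forall>x. norm x \<le> 1 \<and> (\<forall>f\<in>F. norm (blinfun_apply f x) < e) \<longrightarrow> P x"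
    using assms unfolding eventually_weakly_null_filter by (elim exE conjE)
  show thesis by (rule that[OF F]) (simp add: P)
qed

lemma eventually_weakly_null_norm: "eventually (\<lambda>x. norm x \<le> 1) (weakly_null_filter sX)"
  unfolding eventually_weakly_null_filter by (intro exI[of _ "{}"] exI[of _ 1]) simp

lemma eventually_weakly_null_dual:
  assumes "f \<in> dual sX" "0 < e"
  shows "eventually (\<lambda>x. norm (blinfun_apply f x) < e) (weakly_null_filter sX)"
  unfolding eventually_weakly_null_filter using assms by (intro exI[of _ "{f}"] exI[of _ e]) simp

lemma frequently_weakly_null_filterD:
  assumes "frequently P (weakly_null_filter sX)" "finite F" "F \<subseteq> dual sX" "0 < e"
  obtains x where "norm x \<le> 1" "\<And>f. f \<in> F \<Longrightarrow> norm (blinfun_apply f x) < e" "P x"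
  using assms unfolding frequently_def eventually_weakly_null_filter by metis

text \<open>The vector \<open>y\<close> accumulates the choices made so far. The outermost
  \<open>eventually\<close> concerns the first vector of a branch and the innermost the last one, so
  the infimum of the admissible \<open>s\<close> at \<open>y = 0\<close> is an iterated upper
  limit.\<close>

primrec iterated_bound ::
  "('k::real_or_complex_field \<Rightarrow> 'x::real_normed_vector \<Rightarrow> 'x) \<Rightarrow>
   ('x \<Rightarrow>\<^sub>L 'y::real_normed_vector) \<Rightarrow> nat \<Rightarrow> real \<Rightarrow> 'x \<Rightarrow> bool"
  where
    "iterated_bound sX A 0 s y \<longleftrightarrow> norm (blinfun_apply A y) \<le> s"
  | "iterated_bound sX A (Suc n) s y \<longleftrightarrow>
      eventually (\<lambda>x. iterated_bound sX A n s (y + x)) (weakly_null_filter sX)"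

lemma iterated_bound_mono:
  "iterated_bound sX A n s y \<Longrightarrow> s \<le> s' \<Longrightarrow> iterated_bound sX A n s' y"
  by (induction n arbitrary: y) (auto elim: eventually_mono)

text \<open>Eventually each vector has norm at most 1 and adds at most \<open>norm A\<close>. This
  makes the set in \<open>Sigma_n\<close> nonempty and controls remainders in the proof of
  completeness.\<close>

lemma iterated_bound_trivial:
  "norm (blinfun_apply A y) + real n * norm A \<le> s \<Longrightarrow> iterated_bound sX A n s y"
proof (induction n arbitrary: y)
  case (Suc n)
  have "iterated_bound sX A n s (y + x)" if x: "norm x \<le> 1" for x
  proof (rule Suc.IH)
    have "norm (A x) \<le> norm A"
      using norm_blinfun[of A x] mult_left_mono[OF x norm_ge_zero[of A]] by simp
    then have "norm (A (y + x)) \<le> norm (A y) + norm A"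
      using norm_triangle_ineq[of "A y" "A x"] by (simp add: blinfun.add_right)
    then show "norm (A (y + x)) + real n * norm A \<le> s"
      using Suc.prems by (simp add: algebra_simps)
  qed
  then show ?case by (simp add: eventually_mono[OF eventually_weakly_null_norm])
qed simp

text \<open>The two bounds hold along the same filter, hence simultaneously at each level;
  subadditivity of \<Sigma> rests on this.\<close>

lemma iterated_bound_add:
  "iterated_bound sX A n s y \<Longrightarrow> iterated_bound sX B n t y \<Longrightarrow> iterated_bound sX (A + B) n (s + t) y"
proof (induction n arbitrary: y)
  case 0
  then show ?case using norm_triangle_ineq[of "A y" "B y"] by (simp add: blinfun.add_left)
next
  case (Suc n)
  then show ?case by (auto elim: eventually_elim2)
qed

lemma iterated_bound_dominated:
  assumes "\<And>y. norm (blinfun_apply B y) \<le> c * norm (blinfun_apply A y)" "0 \<le> c"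
  shows "iterated_bound sX A n s y \<Longrightarrow> iterated_bound sX B n (c * s) y"
proof (induction n arbitrary: y)
  case 0
  then show ?case using assms(1)[of y] mult_left_mono[OF _ assms(2), of "norm (A y)" s] by simp
qed (auto elim: eventually_mono)

text \<open>Pulling functionals back along \<open>C\<close> gives weak continuity, and
  \<open>norm C \<le> 1\<close> keeps the values in the unit ball.\<close>

lemma filterlim_weakly_null_filter:
  assumes "K_normed_space sW" "K_normed_space sX" and C: "C \<in> operators sW sX" "norm C \<le> 1"
  shows "filterlim (blinfun_apply C) (weakly_null_filter sX) (weakly_null_filter sW)"
  unfolding filterlim_iff
proof (intro allI impI)
  fix P assume "eventually P (weakly_null_filter sX)"
  then obtain F e where F: "finite F" "F \<subseteq> dual sX" "0 < e"
    and P: "\<And>x. norm x \<le> 1 \<Longrightarrow> (\<And>f. f \<in> F \<Longrightarrow> norm (blinfun_apply f x) < e) \<Longrightarrow> P x"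
    by (rule eventually_weakly_null_filterE) iprover
  have "(\<lambda>f. f o\<^sub>L C) ` F \<subseteq> dual sW"
    using F(2) C(1) by (auto simp: subset_iff dual_iff operators_iff assms(1,2))
  moreover have "P (C x)" if "norm x \<le> 1" "\<forall>f\<in>(\<lambda>f. f o\<^sub>L C) ` F. norm (blinfun_apply f x) < e" for x
  proof (rule P)
    show "norm (C x) \<le> 1"
      using norm_blinfun[of C x] mult_mono[OF C(2) that(1)] by simp
  qed (use that(2) in auto)
  ultimately show "eventually (\<lambda>x. P (C x)) (weakly_null_filter sW)"
    unfolding eventually_weakly_null_filter
    using F(1,3) by (intro exI[of _ "(\<lambda>f. f o\<^sub>L C) ` F"] exI[of _ e]) auto
qed

lemma iterated_bound_compose:
  assumes "K_normed_space sW" "K_normed_space sX" and C: "C \<in> operators sW sX" "norm C \<le> 1"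
  shows "iterated_bound sX B n s (C y) \<Longrightarrow> iterated_bound sW (B o\<^sub>L C) n s y"
proof (induction n arbitrary: y)
  case (Suc n)
  then have "eventually (\<lambda>x. iterated_bound sX B n s (C y + C x)) (weakly_null_filter sW)"
    by (intro eventually_compose_filterlim[OF _ filterlim_weakly_null_filter[OF assms]]) simp
  then show ?case
    by (auto elim!: eventually_mono intro!: Suc.IH simp: blinfun.add_right)
qed simp

text \<open>The operator sees a vector only through its value under \<open>f\<close>, which is
  eventually small. The strict inequality leaves slack, of which each level spends a part.\<close>

lemma iterated_bound_rank_one:
  assumes Y: "K_normed_space sY" and f: "f \<in> dual sX"
  shows "norm (blinfun_apply f y) * norm v < s \<Longrightarrow> iterated_bound sX (rank_one sY f v) n s y"
proof (induction n arbitrary: y)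
  case 0
  then show ?case
    by (simp add: K_normed_space.rank_one_apply[OF Y] K_normed_space.norm_scale[OF Y])
next
  case (Suc n)
  \<comment> \<open>The summand 1 makes the denominator positive, and it makes
    \<open>e * norm v\<close> strictly smaller than the slack.\<close>
  define e where "e = (s - norm (f y) * norm v) / (norm v + 1)"
  have "0 < e" using Suc.prems by (simp add: e_def add_nonneg_pos)
  have "iterated_bound sX (rank_one sY f v) n s (y + x)" if x: "norm (f x) < e" for x
  proof (rule Suc.IH)
    have "norm (f x) * norm v \<le> e * norm v" using x by (intro mult_right_mono) auto
    also have "\<dots> < e * (norm v + 1)" using \<open>0 < e\<close> by simp
    also have "\<dots> = s - norm (f y) * norm v"
      using add_nonneg_pos[OF norm_ge_zero[of v] zero_less_one] by (simp add: e_def)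
    finally have "(norm (f y) + norm (f x)) * norm v < s" by (simp add: algebra_simps)
    then show "norm (f (y + x)) * norm v < s"
      using mult_right_mono[OF norm_triangle_ineq[of "f y" "f x"] norm_ge_zero[of v]]
      by (simp add: blinfun.add_right)
  qed
  then show ?case
    using eventually_weakly_null_dual[OF f \<open>0 < e\<close>] by (auto elim!: eventually_mono)
qed

section \<open>Weakly null trees versus iterated bounds\<close>

lemma sum_take_Cons:
  "(\<Sum>i=1..Suc n. x (take i (u # t))) = x [u] + (\<Sum>i=1..n. x (u # take i t))"
proof -
  have "(\<Sum>i=1..Suc n. x (take i (u # t))) = x [u] + (\<Sum>i=Suc 1..Suc n. x (take i (u # t)))"
    by (subst sum.atLeast_Suc_atMost) auto
  also have "(\<Sum>i=Suc 1..Suc n. x (take i (u # t))) = (\<Sum>i=1..n. x (take (Suc i) (u # t)))"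
    by (rule sum.shift_bounds_cl_Suc_ivl)
  finally show ?thesis by simp
qed

text \<open>Tuples grow at the end, but inductions on the height remove the first entry; this
  recursion matches that of \<open>iterated_bound\<close>.\<close>

lemma weakly_null_collection_Suc:
  "weakly_null_collection sX D le (Suc n) x \<longleftrightarrow>
    weakly_null_net sX D le (\<lambda>u. x [u]) \<and>
    (\<forall>u\<in>D. weakly_null_collection sX D le n (\<lambda>t. x (u # t)))"
proof
  assume L: "weakly_null_collection sX D le (Suc n) x"
  show "weakly_null_net sX D le (\<lambda>u. x [u]) \<and>
    (\<forall>u\<in>D. weakly_null_collection sX D le n (\<lambda>t. x (u # t)))"
    unfolding weakly_null_collection_def
  proof (intro conjI ballI impI)
    show "weakly_null_net sX D le (\<lambda>u. x [u])"
      using L[unfolded weakly_null_collection_def, rule_format, of "[]"] by simp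
    show "weakly_null_net sX D le (\<lambda>v. x (u # t @ [v]))"
      if "u \<in> D" "t \<in> lists D" "length t < n" for u t
      using L[unfolded weakly_null_collection_def, rule_format, of "u # t"] that by simp
  qed
next
  assume R: "weakly_null_net sX D le (\<lambda>u. x [u]) \<and>
    (\<forall>u\<in>D. weakly_null_collection sX D le n (\<lambda>t. x (u # t)))"
  show "weakly_null_collection sX D le (Suc n) x"
    unfolding weakly_null_collection_def
  proof (intro ballI impI)
    fix t assume "t \<in> lists D" "length t < Suc n"
    then show "weakly_null_net sX D le (\<lambda>u. x (t @ [u]))"
      using R by (cases t) (auto simp: weakly_null_collection_def)
  qed
qed

text \<open>The successors of a node form a weakly null net, which enters the neighbourhood on which
  the bound of the next level holds. The branch is thus built entry by entry, with \<open>y\<close>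
  carrying the partial sum.\<close>

lemma iterated_bound_imp_branch:
  assumes dir: "directed_set D le"
  shows "iterated_bound sX A n s y \<Longrightarrow> weakly_null_collection sX D le n x \<Longrightarrow>
    (\<And>t. t \<in> lists D \<Longrightarrow> 1 \<le> length t \<Longrightarrow> length t \<le> n \<Longrightarrow> norm (x t) \<le> 1) \<Longrightarrow>
    \<exists>t\<in>lists D. length t = n \<and> norm (A (y + (\<Sum>i=1..n. x (take i t)))) \<le> s"
proof (induction n arbitrary: y x)
  case 0
  then show ?case by (intro bexI[of _ "[]"]) auto
next
  case (Suc n)
  obtain F e where F: "finite F" "F \<subseteq> dual sX" "0 < e"
    and ev: "\<And>z. norm z \<le> 1 \<Longrightarrow> (\<And>f. f \<in> F \<Longrightarrow> norm (blinfun_apply f z) < e) \<Longrightarrow> iterated_bound sX A n s (y + z)"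
    using Suc.prems(1) unfolding iterated_bound.simps
    by (rule eventually_weakly_null_filterE) iprover
  have "weakly_null_net sX D le (\<lambda>u. x [u])"
    using Suc.prems(2) by (simp add: weakly_null_collection_Suc)
  then have "((\<lambda>u. blinfun_apply f (x [u])) \<longlongrightarrow> 0) (net_filter D le)" if "f \<in> F" for f
    using F(2) that by (auto simp: weakly_null_net_def)
  then have "\<forall>f\<in>F. eventually (\<lambda>u. dist (blinfun_apply f (x [u])) 0 < e) (net_filter D le)"
    using F(3) tendstoD by blast
  then have "eventually (\<lambda>u. \<forall>f\<in>F. dist (blinfun_apply f (x [u])) 0 < e) (net_filter D le)"
    using F(1) by (simp add: eventually_ball_finite)
  then obtain u where u: "u \<in> D" "\<forall>v\<in>D. le u v \<longrightarrow> (\<forall>f\<in>F. dist (blinfun_apply f (x [v])) 0 < e)"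
    unfolding eventually_net_filter[OF dir] by blast
  have "le u u" using dir u(1) by (simp add: directed_set_def)
  then have "iterated_bound sX A n s (y + x [u])"
    using u by (intro ev Suc.prems(3)) auto
  moreover have "weakly_null_collection sX D le n (\<lambda>t. x (u # t))"
    using Suc.prems(2) u(1) by (simp add: weakly_null_collection_Suc)
  ultimately obtain t where "t \<in> lists D" "length t = n"
    "norm (A (y + x [u] + (\<Sum>i=1..n. x (u # take i t)))) \<le> s"
    using Suc.IH[of "y + x [u]" "\<lambda>t. x (u # t)"] Suc.prems(3) u(1) by auto
  then show ?case
    using u(1) by (intro bexI[of _ "u # t"]) (auto simp only: sum_take_Cons add.assoc, auto)
qed

text \<open>An index \<open>(F, e)\<close> names a basic weak neighbourhood of 0, and larger indices
  name smaller neighbourhoods: more functionals and a smaller radius.\<close>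

definition weak_nbhd_index ::
  "('k::real_or_complex_field \<Rightarrow> 'x::real_normed_vector \<Rightarrow> 'x) \<Rightarrow> (('x \<Rightarrow>\<^sub>L 'k) set \<times> real) set"
  where "weak_nbhd_index sX = {(F, e). finite F \<and> F \<subseteq> dual sX \<and> 0 < e}"

definition weak_nbhd_le :: "('x set \<times> real) \<Rightarrow> ('x set \<times> real) \<Rightarrow> bool"
  where "weak_nbhd_le p q \<longleftrightarrow> fst p \<subseteq> fst q \<and> snd q \<le> snd p"

lemma directed_weak_nbhd_index: "directed_set (weak_nbhd_index sX) weak_nbhd_le"
  unfolding directed_set_def
proof (intro conjI ballI)
  have "({}, 1) \<in> weak_nbhd_index sX" by (simp add: weak_nbhd_index_def)
  then show "weak_nbhd_index sX \<noteq> {}" by blast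
  fix p q assume "p \<in> weak_nbhd_index sX" "q \<in> weak_nbhd_index sX"
  then show "\<exists>r\<in>weak_nbhd_index sX. weak_nbhd_le p r \<and> weak_nbhd_le q r"
    by (intro bexI[of _ "(fst p \<union> fst q, min (snd p) (snd q))"])
      (auto simp: weak_nbhd_index_def weak_nbhd_le_def)
qed (auto simp: weak_nbhd_le_def)

lemma weakly_null_net_weak_nbhd:
  assumes "\<And>F e f. (F, e) \<in> weak_nbhd_index sX \<Longrightarrow> f \<in> F \<Longrightarrow> norm (blinfun_apply f (x (F, e))) < e"
  shows "weakly_null_net sX (weak_nbhd_index sX) weak_nbhd_le x"
  unfolding weakly_null_net_def
proof (intro ballI tendstoI)
  fix f and e :: real assume "f \<in> dual sX" "0 < e"
  then have "({f}, e) \<in> weak_nbhd_index sX" by (simp add: weak_nbhd_index_def)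
  moreover have "dist (blinfun_apply f (x q)) 0 < e"
    if "q \<in> weak_nbhd_index sX" "weak_nbhd_le ({f}, e) q" for q
    using assms[of "fst q" "snd q" f] that by (auto simp: weak_nbhd_le_def)
  ultimately show "eventually (\<lambda>u. dist (blinfun_apply f (x u)) 0 < e) (net_filter (weak_nbhd_index sX) weak_nbhd_le)"
    unfolding eventually_net_filter[OF directed_weak_nbhd_index] by blast
qed

text \<open>If the bound fails, every basic neighbourhood contains a vector after which it still
  fails. Indexing nodes by neighbourhoods makes these vectors a weakly null net, and the induction
  hypothesis supplies a tree above each of them.\<close>

lemma not_iterated_bound_imp_tree:
  fixes sX :: "'k::real_or_complex_field \<Rightarrow> 'x::real_normed_vector \<Rightarrow> 'x"
  defines "D \<equiv> weak_nbhd_index sX"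
  shows "\<not> iterated_bound sX A n s y \<Longrightarrow>
    \<exists>x. weakly_null_collection sX D weak_nbhd_le n x \<and>
      (\<forall>t\<in>lists D. 1 \<le> length t \<and> length t \<le> n \<longrightarrow> norm (x t) \<le> 1) \<and>
      (\<forall>t\<in>lists D. length t = n \<longrightarrow> s < norm (A (y + (\<Sum>i=1..n. x (take i t)))))"
proof (induction n arbitrary: y)
  case 0
  then show ?case by (auto simp: weakly_null_collection_def)
next
  case (Suc n)
  then have freq: "frequently (\<lambda>x. \<not> iterated_bound sX A n s (y + x)) (weakly_null_filter sX)"
    by (simp add: frequently_def)
  have "\<exists>z. norm z \<le> 1 \<and> (\<forall>f\<in>fst p. norm (blinfun_apply f z) < snd p) \<and> \<not> iterated_bound sX A n s (y + z)"
    if "p \<in> D" for p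
    using frequently_weakly_null_filterD[OF freq, of "fst p" "snd p"] that
    unfolding D_def weak_nbhd_index_def by (metis (mono_tags, lifting) case_prod_beta mem_Collect_eq)
  then obtain z where z: "\<And>p. p \<in> D \<Longrightarrow> norm (z p) \<le> 1"
    "\<And>p f. p \<in> D \<Longrightarrow> f \<in> fst p \<Longrightarrow> norm (blinfun_apply f (z p)) < snd p"
    "\<And>p. p \<in> D \<Longrightarrow> \<not> iterated_bound sX A n s (y + z p)" by metis
  have "\<exists>T. \<forall>p\<in>D. weakly_null_collection sX D weak_nbhd_le n (T p) \<and>
      (\<forall>t\<in>lists D. 1 \<le> length t \<and> length t \<le> n \<longrightarrow> norm (T p t) \<le> 1) \<and>
      (\<forall>t\<in>lists D. length t = n \<longrightarrow> s < norm (A (y + z p + (\<Sum>i=1..n. T p (take i t)))))"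
    by (rule bchoice) (use Suc.IH z(3) in blast)
  then obtain T where T: "\<And>p. p \<in> D \<Longrightarrow> weakly_null_collection sX D weak_nbhd_le n (T p)"
    "\<And>p t. p \<in> D \<Longrightarrow> t \<in> lists D \<Longrightarrow> 1 \<le> length t \<Longrightarrow> length t \<le> n \<Longrightarrow> norm (T p t) \<le> 1"
    "\<And>p t. p \<in> D \<Longrightarrow> t \<in> lists D \<Longrightarrow> length t = n \<Longrightarrow>
      s < norm (A (y + z p + (\<Sum>i=1..n. T p (take i t))))" by blast
  define x where "x t = (if tl t = [] then z (hd t) else T (hd t) (tl t))" for t
  have x1: "x [u] = z u" for u by (simp add: x_def)
  have x2: "x (u # t) = T u t" if "t \<noteq> []" for u t using that by (simp add: x_def)
  have null: "weakly_null_collection sX D weak_nbhd_le (Suc n) x"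
    unfolding weakly_null_collection_Suc
  proof (intro conjI ballI)
    show "weakly_null_net sX D weak_nbhd_le (\<lambda>u. x [u])"
      unfolding x1 D_def by (rule weakly_null_net_weak_nbhd) (use z(2) in \<open>auto simp: D_def\<close>)
    show "weakly_null_collection sX D weak_nbhd_le n (\<lambda>t. x (u # t))" if "u \<in> D" for u
      using T(1)[OF that] by (simp add: weakly_null_collection_def x2)
  qed
  have ball: "norm (x t) \<le> 1" if "t \<in> lists D" "1 \<le> length t" "length t \<le> Suc n" for t
  proof (cases t)
    case (Cons u t')
    then show ?thesis using that z(1)[of u] T(2)[of u t'] by (cases "t' = []") (auto simp: x1 x2 Suc_le_eq)
  qed (use that in simp)
  have large: "s < norm (A (y + (\<Sum>i=1..Suc n. x (take i t))))"
    if "t \<in> lists D" "length t = Suc n" for t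
  proof (cases t)
    case (Cons u t')
    have "(\<Sum>i=1..n. x (u # take i t')) = (\<Sum>i=1..n. T u (take i t'))"
      using that Cons by (intro sum.cong x2) auto
    then show ?thesis
      using T(3)[of u t'] that unfolding Cons sum_take_Cons by (simp add: x1 add.assoc)
  qed (use that in simp)
  show ?case using null ball large by (intro exI[of _ x]) blast
qed

lemma iterated_bound_imp_tree_bound:
  assumes "iterated_bound sX A n s 0"
  shows "tree_bound TYPE('d) sX A n s"
  unfolding tree_bound_def
proof (intro allI impI, elim conjE)
  fix D :: "'d set" and le x
  assume "directed_set D le" "weakly_null_collection sX D le n x"
    "\<forall>t\<in>lists D. 1 \<le> length t \<and> length t \<le> n \<longrightarrow> x t \<in> cball 0 1"
  then obtain t where t: "t \<in> {t\<in>lists D. length t = n}" "norm (A (\<Sum>i=1..n. x (take i t))) \<le> s"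
    using iterated_bound_imp_branch[OF _ assms] by fastforce
  have "(INF t\<in>{t\<in>lists D. length t = n}. norm (A (\<Sum>i=1..n. x (take i t))))
      \<le> norm (A (\<Sum>i=1..n. x (take i t)))"
    by (rule cINF_lower[OF _ t(1)]) (rule bdd_belowI2[where m = 0], simp)
  then show "(INF t\<in>{t\<in>lists D. length t = n}. norm (A (\<Sum>i=1..n. x (take i t)))) \<le> s"
    using t(2) by simp
qed

text \<open>Otherwise there is a tree whose branches all exceed \<open>s'\<close>. Its infimum is at
  least \<open>s'\<close>, so the strict gap to \<open>s\<close> yields the contradiction.\<close>

lemma tree_bound_imp_iterated_bound:
  fixes sX :: "'k::real_or_complex_field \<Rightarrow> 'x::real_normed_vector \<Rightarrow> 'x"
  assumes tree: "tree_bound TYPE('x set) sX A n s" and less: "s < s'"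
  shows "iterated_bound sX A n s' 0"
proof (rule ccontr)
  let ?D = "weak_nbhd_index sX"
  assume "\<not> iterated_bound sX A n s' 0"
  then obtain x where x: "weakly_null_collection sX ?D weak_nbhd_le n x"
      "\<forall>t\<in>lists ?D. 1 \<le> length t \<and> length t \<le> n \<longrightarrow> x t \<in> cball 0 1"
    and large: "\<forall>t\<in>lists ?D. length t = n \<longrightarrow> s' < norm (A (\<Sum>i=1..n. x (take i t)))"
    using not_iterated_bound_imp_tree[of sX A n s' 0] by auto
  let ?B = "{t\<in>lists ?D. length t = n}"
  have "({}, 1) \<in> ?D" by (simp add: weak_nbhd_index_def)
  then have "replicate n ({}, 1) \<in> ?B" by (auto simp: in_lists_conv_set)
  then have "?B \<noteq> {}" by blast
  then have "s' \<le> (INF t\<in>?B. norm (A (\<Sum>i=1..n. x (take i t))))"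
    by (rule cINF_greatest) (use large in \<open>auto intro: less_imp_le\<close>)
  \<comment> \<open>The tree is indexed by pairs \<open>(F, e)\<close>, not by sets of vectors, so
    the bound has to be transferred to another index type.\<close>
  also have "\<dots> \<le> s"
    using tree_bound_any_type[OF tree] directed_weak_nbhd_index x unfolding tree_bound_def by blast
  finally show False using less by simp
qed

text \<open>Tree bounds and iterated bounds agree up to an arbitrarily small loss, whence all
  \<open>s' > s\<close> on the right. The condition \<open>0 \<le> s\<close> reflects that only
  positive numbers enter the infimum.\<close>

lemma Sigma_n_le_iff:
  fixes sX :: "'k::real_or_complex_field \<Rightarrow> 'x::real_normed_vector \<Rightarrow> 'x"
  shows "Sigma_n sX A n \<le> s \<longleftrightarrow> 0 \<le> s \<and> (\<forall>s'>s. iterated_bound sX A n s' 0)"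
proof -
  let ?S = "{s. s > 0 \<and> tree_bound TYPE('x set) sX A n s}"
  have "iterated_bound sX A n (real n * norm A + 1) 0"
    by (rule iterated_bound_trivial) simp
  then have ne: "real n * norm A + 1 \<in> ?S"
    by (simp add: iterated_bound_imp_tree_bound add_nonneg_pos)
  have bdd: "bdd_below ?S" by (rule bdd_belowI[of _ 0]) simp
  show ?thesis
  proof
    assume le: "Sigma_n sX A n \<le> s"
    have "0 \<le> Inf ?S"
    proof (rule cInf_greatest)
      show "?S \<noteq> {}" using ne by fast
    qed simp
    then have "0 \<le> Sigma_n sX A n" by (simp only: Sigma_n_def)
    moreover have "iterated_bound sX A n s' 0" if "s < s'" for s'
    proof -
      have "Inf ?S < s'" using le that by (simp add: Sigma_n_def)
      then obtain r where "r \<in> ?S" "r < s'" using ne cInf_lessD[of ?S s'] by fast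
      then show ?thesis by (intro tree_bound_imp_iterated_bound[of sX A n r]) auto
    qed
    ultimately show "0 \<le> s \<and> (\<forall>s'>s. iterated_bound sX A n s' 0)" using le by auto
  next
    assume R: "0 \<le> s \<and> (\<forall>s'>s. iterated_bound sX A n s' 0)"
    show "Sigma_n sX A n \<le> s"
    proof (rule dense_ge)
      fix s' assume "s < s'"
      then show "Sigma_n sX A n \<le> s'" unfolding Sigma_n_def
        using R by (intro cInf_lower bdd) (auto intro: iterated_bound_imp_tree_bound)
    qed
  qed
qed

lemma Sigma_op_le_iff:
  assumes "0 \<le> S"
  shows "Sigma_op sX A \<le> ennreal S \<longleftrightarrow> (\<forall>n. \<forall>s>S. iterated_bound sX A n s 0)"
proof -
  have "Sigma_op sX A \<le> ennreal S \<longleftrightarrow> (\<forall>n\<ge>1. Sigma_n sX A n \<le> S)"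
    using assms by (auto simp: Sigma_op_def SUP_le_iff ennreal_le_iff)
  also have "\<dots> \<longleftrightarrow> (\<forall>n\<ge>1. \<forall>s>S. iterated_bound sX A n s 0)"
    using assms by (simp add: Sigma_n_le_iff)
  also have "\<dots> \<longleftrightarrow> (\<forall>n. \<forall>s>S. iterated_bound sX A n s 0)"
  proof -
    \<comment> \<open>The supremum starts at \<open>n = 1\<close>; the case \<open>n = 0\<close>
      holds because \<open>A 0 = 0\<close>.\<close>
    have "iterated_bound sX A 0 s 0" if "S < s" for s using that assms by simp
    then show ?thesis by (metis less_one not_le)
  qed
  finally show ?thesis .
qed

section \<open>Summable Szlenk index and finiteness of \<open>\<Sigma>\<close>\<close>

lemma topspace_weak_star: "topspace (weak_star sX) = dual sX"
  by (simp add: weak_star_def strong_operator_topology_topspace)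

lemma openin_weak_star_basic:
  assumes "finite Z"
  shows "openin (weak_star sX) {g \<in> dual sX. \<forall>z\<in>Z. norm (blinfun_apply g z - blinfun_apply f z) < e}"
proof -
  have "openin strong_operator_topology {g. \<forall>z\<in>Z. blinfun_apply g z \<in> ball (blinfun_apply f z) e}"
    by (rule strong_operator_topology_basis[where x = "\<lambda>z. z", OF assms]) simp
  moreover have "{g \<in> dual sX. \<forall>z\<in>Z. norm (blinfun_apply g z - blinfun_apply f z) < e}
      = {g. \<forall>z\<in>Z. blinfun_apply g z \<in> ball (blinfun_apply f z) e} \<inter> dual sX"
    by (auto simp: dist_norm norm_minus_commute)
  ultimately show ?thesis unfolding weak_star_def openin_subtopology by blast
qed

lemma adjoint_image_ball_bounds:
  assumes "K_normed_space sX" "K_normed_space sY" "A \<in> operators sX sY"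
  shows "adjoint_image_ball sY A \<subseteq> dual sX" "bounded (adjoint_image_ball sY A)"
    "\<And>f. f \<in> adjoint_image_ball sY A \<Longrightarrow> norm f \<le> norm A"
    "\<And>f y. f \<in> adjoint_image_ball sY A \<Longrightarrow> norm (blinfun_apply f y) \<le> norm (A y)"
proof -
  show "adjoint_image_ball sY A \<subseteq> dual sX"
    using assms(3) by (auto simp: adjoint_image_ball_def dual_iff operators_iff assms(1,2))
  show *: "norm f \<le> norm A" if f: "f \<in> adjoint_image_ball sY A" for f
  proof -
    obtain g where g: "f = g o\<^sub>L A" "norm g \<le> 1" using f by (auto simp: adjoint_image_ball_def)
    have "norm f \<le> norm g * norm A" unfolding g(1) by (rule norm_blinfun_compose)
    also have "\<dots> \<le> 1 * norm A" by (rule mult_right_mono[OF g(2)]) simp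
    finally show ?thesis by simp
  qed
  then show "bounded (adjoint_image_ball sY A)" by (auto simp: bounded_iff)
  show "norm (blinfun_apply f y) \<le> norm (A y)" if f: "f \<in> adjoint_image_ball sY A" for f y
  proof -
    obtain g where g: "f = g o\<^sub>L A" "norm g \<le> 1" using f by (auto simp: adjoint_image_ball_def)
    have "norm (g (A y)) \<le> norm g * norm (A y)" by (rule norm_blinfun)
    also have "\<dots> \<le> 1 * norm (A y)" by (rule mult_right_mono[OF g(2)]) simp
    finally show ?thesis by (simp add: g(1))
  qed
qed

text \<open>This is the Banach-Alaoglu theorem: the dual unit ball, viewed as a set of functions, is
  cut out by closed conditions from a product of compact balls.\<close>

lemma compact_linear_functions:
  fixes sY :: "'k::real_or_complex_field \<Rightarrow> 'y::real_normed_vector \<Rightarrow> 'y"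
  shows "compact {h. (\<forall>x. norm (h x) \<le> norm x) \<and> (\<forall>x y. h (x + y) = h x + h y) \<and>
    (\<forall>c x. h (sY c x) = c * h x)}"
    (is "compact ?S")
proof -
  have "compactin (product_topology (\<lambda>_. euclidean) UNIV) (PiE UNIV (\<lambda>x :: 'y. cball (0 :: 'k) (norm x)))"
    by (simp add: compactin_PiE compact_cball_scalar)
  then have "compact (PiE UNIV (\<lambda>x :: 'y. cball (0 :: 'k) (norm x)))"
    by (simp add: euclidean_product_topology)
  moreover have "closed {h :: 'y \<Rightarrow> 'k. (\<forall>x y. h (x + y) = h x + h y) \<and> (\<forall>c x. h (sY c x) = c * h x)}"
    by (intro closed_Collect_conj closed_Collect_all closed_Collect_eq continuous_intros
        continuous_on_product_coordinates)
  ultimately have "compact (PiE UNIV (\<lambda>x :: 'y. cball (0 :: 'k) (norm x)) \<inter>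
      {h. (\<forall>x y. h (x + y) = h x + h y) \<and> (\<forall>c x. h (sY c x) = c * h x)})"
    by (rule compact_Int_closed)
  also have "PiE UNIV (\<lambda>x :: 'y. cball (0 :: 'k) (norm x)) \<inter>
      {h. (\<forall>x y. h (x + y) = h x + h y) \<and> (\<forall>c x. h (sY c x) = c * h x)} = ?S"
    by (auto simp: PiE_UNIV_domain)
  finally show ?thesis .
qed

text \<open>Compactness of the adjoint image, in the form used later. The functionals are lifted to
  the dual ball of the codomain, where a cluster point exists, and composition with \<open>A\<close>
  is weak* continuous.\<close>

lemma weak_star_cluster_point:
  fixes sY :: "'k::real_or_complex_field \<Rightarrow> 'y::real_normed_vector \<Rightarrow> 'y"
  assumes X: "K_normed_space sX" and Y: "K_normed_space sY" and A: "A \<in> operators sX sY"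
    and F: "F \<noteq> bot"
    and ev: "eventually (\<lambda>z. f z \<in> adjoint_image_ball sY A) F"
  obtains f0 where "f0 \<in> adjoint_image_ball sY A"
    "\<And>V. openin (weak_star sX) V \<Longrightarrow> f0 \<in> V \<Longrightarrow> frequently (\<lambda>z. f z \<in> V) F"
proof -
  let ?S = "{h. (\<forall>x. norm (h x) \<le> norm x) \<and> (\<forall>x y. h (x + y) = h x + h y) \<and>
    (\<forall>c x. h (sY c x) = c * h x)}"
  have "\<exists>g. f z \<in> adjoint_image_ball sY A \<longrightarrow> g \<in> dual sY \<and> norm g \<le> 1 \<and> f z = g o\<^sub>L A" for z
    by (auto simp: adjoint_image_ball_def)
  then obtain g where g: "\<And>z. f z \<in> adjoint_image_ball sY A \<Longrightarrow>
      g z \<in> dual sY \<and> norm (g z) \<le> 1 \<and> f z = g z o\<^sub>L A" by metis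
  let ?G = "filtermap (\<lambda>z. blinfun_apply (g z)) F"
  have "eventually (\<lambda>h. h \<in> ?S) ?G"
    unfolding eventually_filtermap
  proof (rule eventually_mono[OF ev])
    fix z assume "f z \<in> adjoint_image_ball sY A"
    note gz = g[OF this]
    have "norm (g z x) \<le> norm x" for x
      using norm_blinfun[of "g z" x] mult_right_mono[of "norm (g z)" 1 "norm x"] gz by simp
    then show "blinfun_apply (g z) \<in> ?S" using gz by (simp add: dual_iff[OF Y] blinfun.add_right)
  qed
  moreover have "?G \<noteq> bot" using F by (simp add: filtermap_bot_iff)
  ultimately obtain h where h: "h \<in> ?S" "inf (nhds h) ?G \<noteq> bot"
    using compact_linear_functions[of sY] unfolding compact_filter by blast
  have "bounded_linear h"
  proof (rule bounded_linear_intro[where K = 1])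
    show "h (t *\<^sub>R x) = t *\<^sub>R h x" for t x
      using h(1) by (simp add: K_normed_space.scale_of_real[OF Y, symmetric] scaleR_conv_of_real)
  qed (use h(1) in auto)
  then have app: "blinfun_apply (Blinfun h) = h" by (rule bounded_linear_Blinfun_apply)
  have "Blinfun h \<in> dual sY" using h(1) by (simp add: dual_iff[OF Y] app)
  moreover have "norm (Blinfun h) \<le> 1" by (rule norm_blinfun_bound) (use h(1) in \<open>auto simp: app\<close>)
  ultimately have K: "Blinfun h o\<^sub>L A \<in> adjoint_image_ball sY A"
    by (auto simp: adjoint_image_ball_def)
  have "frequently (\<lambda>z. f z \<in> V) F" if V: "openin (weak_star sX) V" "Blinfun h o\<^sub>L A \<in> V" for V
  proof -
    obtain T where T: "openin strong_operator_topology T" "V = T \<inter> dual sX"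
      using V(1) by (auto simp: weak_star_def openin_subtopology)
    then obtain U where U: "open U" "T = blinfun_apply -` U"
      by (auto simp: strong_operator_topology_def openin_pullback_topology)
    let ?W = "(\<lambda>h' x. h' (A x)) -` U"
    have W: "open ?W"
      by (intro open_vimage[OF U(1)] continuous_on_coordinatewise_then_product
          continuous_on_product_coordinates)
    have compose: "blinfun_apply (k o\<^sub>L A) = (\<lambda>x. k (A x))" for k :: "'y \<Rightarrow>\<^sub>L 'k"
      by (rule ext) simp
    have "h \<in> ?W" using V(2) T(2) U(2) by (simp add: app compose)
    then have "eventually (\<lambda>h'. h' \<in> ?W) (nhds h)" using W by (rule eventually_nhds_in_open[rotated])
    then have "frequently (\<lambda>h'. h' \<in> ?W) ?G"
      using h(2) unfolding frequently_def trivial_limit_def eventually_inf by blast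
    then have "frequently (\<lambda>z. blinfun_apply (g z) \<in> ?W) F"
      by (simp add: frequently_def eventually_filtermap)
    then show ?thesis
    proof (rule frequently_rev_mp)
      show "eventually (\<lambda>z. blinfun_apply (g z) \<in> ?W \<longrightarrow> f z \<in> V) F"
      proof (rule eventually_mono[OF ev], rule impI)
        fix z assume z: "f z \<in> adjoint_image_ball sY A" "blinfun_apply (g z) \<in> ?W"
        have "f z \<in> dual sX" using adjoint_image_ball_bounds(1)[OF X Y A] z(1) by blast
        moreover have "blinfun_apply (f z) \<in> U" using g[OF z(1)] z(2) by (simp add: compose)
        ultimately show "f z \<in> V" using T(2) U(2) by simp
      qed
    qed
  qed
  with K show thesis by (rule that)
qed

section \<open>Relative weak* closedness of the derived sets\<close>

lemma szlenk_deriv_subset: "szlenk_deriv sX e L \<subseteq> L"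
  by (auto simp: szlenk_deriv_def)

lemma foldr_szlenk_deriv_subset: "foldr (szlenk_deriv sX) es K \<subseteq> K"
  by (induction es) (use szlenk_deriv_subset in force)+

text \<open>A neighbourhood of a limit point \<open>f\<close> is also a neighbourhood of some point
  of the derived set, so its trace has large diameter. Membership in the preceding set comes from
  the induction, down to \<open>K\<close> where it is assumed.\<close>

lemma foldr_szlenk_deriv_closed:
  "f \<in> K \<Longrightarrow> f \<in> weak_star sX closure_of foldr (szlenk_deriv sX) es K \<Longrightarrow>
    f \<in> foldr (szlenk_deriv sX) es K"
proof (induction es)
  case (Cons e es)
  let ?L = "foldr (szlenk_deriv sX) es K"
  have cl: "f \<in> weak_star sX closure_of szlenk_deriv sX e ?L" using Cons.prems by simp
  then have f: "f \<in> ?L"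
    using Cons closure_of_mono[OF szlenk_deriv_subset] by blast
  moreover have "e < diameter (V \<inter> ?L)" if V: "openin (weak_star sX) V" "f \<in> V" and "0 < e" for V
  proof -
    obtain g where "g \<in> szlenk_deriv sX e ?L" "g \<in> V" using cl V by (auto simp: in_closure_of)
    then show ?thesis using V(1) \<open>0 < e\<close> by (auto simp: szlenk_deriv_def)
  qed
  ultimately have "f \<in> szlenk_deriv sX e ?L" by (simp add: szlenk_deriv_def)
  then show ?case by simp
qed simp

section \<open>From nonempty derived sets to large trees\<close>

lemma finite_weak_net:
  fixes F :: "('x::real_normed_vector \<Rightarrow>\<^sub>L 'k::real_or_complex_field) set"
  assumes "finite F" "0 < e"
  shows "S \<subseteq> cball 0 1 \<Longrightarrow>
    \<exists>Z\<subseteq>S. finite Z \<and> (\<forall>x\<in>S. \<exists>z\<in>Z. \<forall>f\<in>F. norm (blinfun_apply f x - blinfun_apply f z) < e)"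
  using assms(1)
proof (induction F arbitrary: S rule: finite_induct)
  case empty
  then show ?case by (cases "S = {}") (fastforce, metis all_not_in_conv empty_subsetI finite.emptyI finite_insert insert_subset insertI1)
next
  case (insert f F)
  have img: "blinfun_apply f ` S \<subseteq> cball 0 (norm f)"
  proof clarify
    fix x assume "x \<in> S"
    then have "norm x \<le> 1" using insert.prems by auto
    then show "f x \<in> cball 0 (norm f)"
      using norm_blinfun[of f x] mult_left_mono[of "norm x" 1 "norm f"] by simp
  qed
  \<comment> \<open>The values of \<open>f\<close> lie in a compact ball, covered by finitely many
    balls of radius \<open>e / 2\<close>. Two points of \<open>S\<close> with values in the same
    small ball differ by less than \<open>e\<close> under \<open>f\<close>.\<close>
  obtain C where C: "finite C" "cball (0 :: 'k) (norm f) \<subseteq> (\<Union>c\<in>C. ball c (e / 2))"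
    using compact_cball_scalar[of "norm f", unfolded compact_eq_totally_bounded] half_gt_zero[OF assms(2)]
    by blast
  define S' where "S' c = {x\<in>S. f x \<in> ball c (e / 2)}" for c
  \<comment> \<open>The induction hypothesis is applied within each piece, so that net points have
    their values in the same small ball as the points they approximate.\<close>
  have "\<exists>Z\<subseteq>S' c. finite Z \<and>
      (\<forall>x\<in>S' c. \<exists>z\<in>Z. \<forall>f\<in>F. norm (blinfun_apply f x - blinfun_apply f z) < e)" for c
    by (rule insert.IH) (use insert.prems in \<open>auto simp: S'_def\<close>)
  then have "\<forall>c. \<exists>Z. Z \<subseteq> S' c \<and> finite Z \<and>
      (\<forall>x\<in>S' c. \<exists>z\<in>Z. \<forall>f\<in>F. norm (blinfun_apply f x - blinfun_apply f z) < e)" by simp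
  then obtain Z where Z: "\<forall>c. Z c \<subseteq> S' c \<and> finite (Z c) \<and>
      (\<forall>x\<in>S' c. \<exists>z\<in>Z c. \<forall>f\<in>F. norm (blinfun_apply f x - blinfun_apply f z) < e)"
    by (rule exE[OF choice])
  show ?case
  proof (intro exI[of _ "\<Union>c\<in>C. Z c"] conjI ballI)
    fix x assume x: "x \<in> S"
    then obtain c where c: "c \<in> C" "f x \<in> ball c (e / 2)" using img C(2) by blast
    then obtain z where z: "z \<in> Z c" "\<forall>f\<in>F. norm (blinfun_apply f x - blinfun_apply f z) < e"
      using Z x by (force simp: S'_def)
    have "f z \<in> ball c (e / 2)" using Z z(1) by (auto simp: S'_def)
    then have "norm (f x - f z) < e"
      using c(2) dist_triangle_half_r[of c "f x" e "f z"] by (simp add: dist_norm)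
    then show "\<exists>z\<in>\<Union>c\<in>C. Z c. \<forall>f\<in>insert f F. norm (blinfun_apply f x - blinfun_apply f z) < e"
      using z c(1) by (intro bexI[of _ z]) auto
  qed (use Z C(1) in \<open>auto simp: S'_def\<close>)
qed

text \<open>A functional of norm \<open>> e\<close> that is small on a finite weak net of the unit ball is still large
  on a weakly small vector, namely on \<open>(x - z) / 2\<close> where \<open>x\<close> almost norms it and \<open>z\<close> is a point of
  the net close to \<open>x\<close>.\<close>

lemma weakly_small_norming_vector:
  fixes sX :: "'k::real_or_complex_field \<Rightarrow> 'x::real_normed_vector \<Rightarrow> 'x"
  assumes X: "K_normed_space sX" and F: "finite F" "F \<subseteq> dual sX" and d: "0 < d"
  obtains Z where "finite Z"
    "\<And>h e. h \<in> dual sX \<Longrightarrow> 0 \<le> e \<Longrightarrow> e < norm h \<Longrightarrow> (\<And>z. z \<in> Z \<Longrightarrow> norm (blinfun_apply h z) < d) \<Longrightarrow>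
      \<exists>x. norm x \<le> 1 \<and> (\<forall>f\<in>F. norm (blinfun_apply f x) < d) \<and> (e - d) / 2 < scalar_Re (h x)"
proof -
  obtain Z where Z: "Z \<subseteq> cball 0 1" "finite Z"
    "\<And>x. x \<in> cball 0 1 \<Longrightarrow> \<exists>z\<in>Z. \<forall>f\<in>F. norm (blinfun_apply f x - blinfun_apply f z) < d"
    using finite_weak_net[OF F(1) d, of "cball 0 1"] by blast
  have "\<exists>x. norm x \<le> 1 \<and> (\<forall>f\<in>F. norm (blinfun_apply f x) < d) \<and> (e - d) / 2 < scalar_Re (h x)"
    if h: "h \<in> dual sX" "0 \<le> e" "e < norm h" "\<And>z. z \<in> Z \<Longrightarrow> norm (blinfun_apply h z) < d" for h e
  proof -
    obtain x where x: "norm x \<le> 1" "e < scalar_Re (h x)"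
      using Re_norming_vector[OF X h(1-3)] by blast
    then obtain z where z: "z \<in> Z" "\<forall>f\<in>F. norm (blinfun_apply f x - blinfun_apply f z) < d"
      using Z(3)[of x] by auto
    show ?thesis
    proof (intro exI[of _ "(1 / 2) *\<^sub>R (x - z)"] conjI ballI)
      have "norm z \<le> 1" using Z(1) z(1) by auto
      then show "norm ((1 / 2) *\<^sub>R (x - z)) \<le> 1"
        using norm_triangle_ineq4[of x z] x(1) by simp
      show "norm (blinfun_apply f ((1 / 2) *\<^sub>R (x - z))) < d" if "f \<in> F" for f
        using z(2)[rule_format, OF that] norm_ge_zero[of "f x - f z"] d
        by (simp add: blinfun.scaleR_right blinfun.diff_right)
      show "(e - d) / 2 < scalar_Re (h ((1 / 2) *\<^sub>R (x - z)))"
        using x(2) scalar_Re_le[of "h z"] h(4)[OF z(1)]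
        by (simp add: blinfun.scaleR_right blinfun.diff_right scalar_Re_scaleR scalar_Re_diff)
    qed
  qed
  with Z(2) show thesis by (rule that)
qed

lemma dual_diff:
  assumes "K_normed_space sX" "f \<in> dual sX" "g \<in> dual sX"
  shows "f - g \<in> dual sX"
  using assms(2,3) by (simp add: dual_iff[OF assms(1)] blinfun.diff_left right_diff_distrib)

text \<open>The neighbourhood \<open>V\<close> controls a finite net \<open>Z\<close> and the point
  \<open>y\<close>. The factor 1/4 comes from two halvings: one of two points at distance more than
  \<open>e\<close> is farther than \<open>e / 2\<close> from \<open>f\<close>, and making the
  norming vector weakly small by halving a difference loses another factor 2.\<close>

lemma szlenk_deriv_witness:
  fixes sX :: "'k::real_or_complex_field \<Rightarrow> 'x::real_normed_vector \<Rightarrow> 'x"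
  assumes X: "K_normed_space sX" and L: "L \<subseteq> dual sX" "bounded L"
    and f: "f \<in> szlenk_deriv sX e L" and e: "0 < e" and F: "finite F" "F \<subseteq> dual sX" and d: "0 < d"
  obtains g x where "g \<in> L" "norm x \<le> 1" "\<And>\<phi>. \<phi> \<in> F \<Longrightarrow> norm (blinfun_apply \<phi> x) < d"
    "e / 4 - d < scalar_Re (blinfun_apply (g - f) x)" "norm (blinfun_apply (g - f) y) < d"
proof -
  obtain Z where Z: "finite Z"
    "\<And>h e. h \<in> dual sX \<Longrightarrow> 0 \<le> e \<Longrightarrow> e < norm h \<Longrightarrow> (\<And>z. z \<in> Z \<Longrightarrow> norm (blinfun_apply h z) < d) \<Longrightarrow>
      \<exists>x. norm x \<le> 1 \<and> (\<forall>f\<in>F. norm (blinfun_apply f x) < d) \<and> (e - d) / 2 < scalar_Re (h x)"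
    using weakly_small_norming_vector[OF X F d] by metis
  define V where "V = {g \<in> dual sX. \<forall>z\<in>insert y Z. norm (blinfun_apply g z - blinfun_apply f z) < d}"
  have fL: "f \<in> L" using f szlenk_deriv_subset by blast
  then have "openin (weak_star sX) V" "f \<in> V"
    using Z(1) L(1) d openin_weak_star_basic[of "insert y Z" sX f d] by (auto simp: V_def)
  then have "e < diameter (V \<inter> L)" using f e by (auto simp: szlenk_deriv_def)
  then obtain g h where gh: "g \<in> V \<inter> L" "h \<in> V \<inter> L" "e < dist g h"
    using diameter_lower_bounded[of "V \<inter> L" e] L(2) e by (auto simp: bounded_Int)
  have "dist g h \<le> dist g f + dist h f" by (rule dist_triangle2)
  then obtain k where k: "k \<in> V" "k \<in> L" "e / 2 < norm (k - f)"
    using gh by (cases "e / 2 < dist g f") (auto simp: dist_norm)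
  have small: "norm (blinfun_apply (k - f) z) < d" if "z \<in> insert y Z" for z
    using k(1) that by (auto simp: V_def blinfun.diff_left)
  have "k - f \<in> dual sX" using L(1) k(2) fL by (intro dual_diff[OF X]) auto
  from Z(2)[OF this _ k(3)] obtain x where x: "norm x \<le> 1" "\<forall>f\<in>F. norm (blinfun_apply f x) < d"
    "(e / 2 - d) / 2 < scalar_Re ((k - f) x)"
    using small e by auto
  show thesis
    by (rule that[of k x]) (use k x small[of y] d in auto)
qed

text \<open>Passing from \<open>f\<close> to the witness \<open>g\<close> and from \<open>y\<close>
  to \<open>y + x\<close> uses up one derivation and raises the real part by almost
  \<open>e / 4\<close>. At the end, the real part of the functional at \<open>y\<close> is at most
  \<open>norm (A y)\<close>.\<close>

lemma szlenk_imp_not_iterated_bound: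
  fixes sX :: "'k::real_or_complex_field \<Rightarrow> 'x::real_normed_vector \<Rightarrow> 'x"
    and sY :: "'k \<Rightarrow> 'y::real_normed_vector \<Rightarrow> 'y"
  assumes X: "K_normed_space sX" and Y: "K_normed_space sY" and A: "A \<in> operators sX sY"
  shows "f \<in> foldr (szlenk_deriv sX) es (adjoint_image_ball sY A) \<Longrightarrow>
    s < scalar_Re (f y) + sum_list es / 4 \<Longrightarrow> \<not> iterated_bound sX A (length es) s y"
proof (induction es arbitrary: f y)
  case Nil
  then have "scalar_Re (f y) \<le> norm (A y)"
    using adjoint_image_ball_bounds(4)[OF X Y A, of f y] scalar_Re_le[of "f y"] by simp
  then show ?case using Nil by simp
next
  case (Cons e es)
  let ?L = "foldr (szlenk_deriv sX) es (adjoint_image_ball sY A)"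
  have L: "?L \<subseteq> dual sX" "bounded ?L"
    using foldr_szlenk_deriv_subset adjoint_image_ball_bounds(1,2)[OF X Y A]
    by (blast, blast intro: bounded_subset)
  have f: "f \<in> szlenk_deriv sX e ?L" using Cons.prems(1) by simp
  then have fL: "f \<in> ?L" using szlenk_deriv_subset by blast
  show ?case
  proof
    assume "iterated_bound sX A (length (e # es)) s y"
    then obtain F d where F: "finite F" "F \<subseteq> dual sX" "0 < d"
      and it: "\<And>x. norm x \<le> 1 \<Longrightarrow> (\<And>f. f \<in> F \<Longrightarrow> norm (blinfun_apply f x) < d) \<Longrightarrow>
        iterated_bound sX A (length es) s (y + x)"
      unfolding list.size(4) add_0_right One_nat_def add_Suc_right iterated_bound.simps
      by (rule eventually_weakly_null_filterE) iprover
    show False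
    proof (cases "e \<le> 0")
      case True
      \<comment> \<open>A nonpositive \<open>e\<close> leaves the set unchanged and does not raise
        the sum, so the vector 0 and the same functional suffice.\<close>
      have "iterated_bound sX A (length es) s (y + 0)" by (rule it) (use F(3) in auto)
      moreover have "s < scalar_Re (f y) + sum_list es / 4"
        using Cons.prems(2) True by (simp add: add_divide_distrib)
      ultimately show False using Cons.IH[OF fL, of y] by simp
    next
      case False
      \<comment> \<open>One third of the slack, because three errors occur: in
        \<open>(g - f) x\<close>, in \<open>(g - f) y\<close> and in \<open>f x\<close>. The last
        one is small since \<open>f\<close> is added to \<open>F\<close> below.\<close>
      define d' where "d' = min d ((scalar_Re (f y) + sum_list (e # es) / 4 - s) / 3)"
      have d': "0 < d'" "d' \<le> d" using F(3) Cons.prems(2) by (auto simp: d'_def)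
      have d'3: "d' \<le> (scalar_Re (f y) + sum_list (e # es) / 4 - s) / 3"
        unfolding d'_def by (rule min.cobounded2)
      have "finite (insert f F)" "insert f F \<subseteq> dual sX" "0 < e" using F fL L(1) False by auto
      note witness = szlenk_deriv_witness[OF X L f this(3,1,2) d'(1), of y]
      obtain g x where g: "g \<in> ?L" "norm x \<le> 1"
        "\<And>\<phi>. \<phi> \<in> insert f F \<Longrightarrow> norm (blinfun_apply \<phi> x) < d'"
        "e / 4 - d' < scalar_Re (blinfun_apply (g - f) x)" "norm (blinfun_apply (g - f) y) < d'"
        by (rule witness) iprover
      have "iterated_bound sX A (length es) s (y + x)"
        using g(2,3) d'(2) by (intro it) (auto intro: less_le_trans)
      moreover have "s < scalar_Re (g (y + x)) + sum_list es / 4"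
        using g(3)[of f] g(4,5) d'3 abs_scalar_Re_le[of "f x"] abs_scalar_Re_le[of "(g - f) y"]
        by (simp add: blinfun.add_right blinfun.diff_left scalar_Re_add scalar_Re_diff add_divide_distrib)
      ultimately show False using Cons.IH[OF g(1)] by blast
    qed
  qed
qed

lemma summable_Szlenk_const_if_Sigma_op_le:
  assumes X: "K_normed_space sX" and Y: "K_normed_space sY" and A: "A \<in> operators sX sY"
    and S: "0 \<le> S" "Sigma_op sX A \<le> ennreal S"
  shows "summable_Szlenk_const sX (4 * S) (adjoint_image_ball sY A)"
  unfolding summable_Szlenk_const_def
proof (intro allI impI, elim conjE)
  fix es assume "foldr (szlenk_deriv sX) es (adjoint_image_ball sY A) \<noteq> {}"
  then obtain f where f: "f \<in> foldr (szlenk_deriv sX) es (adjoint_image_ball sY A)" by blast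
  show "sum_list es \<le> 4 * S"
  proof (rule ccontr)
    assume "\<not> sum_list es \<le> 4 * S"
    then obtain s where s: "S < s" "s < sum_list es / 4"
      using dense[of S "sum_list es / 4"] by auto
    then have "\<not> iterated_bound sX A (length es) s 0"
      using szlenk_imp_not_iterated_bound[OF X Y A f, of s 0] scalar_Re_of_real[of 0, where 'k='a] by simp
    then show False using S s(1) by (simp add: Sigma_op_le_iff)
  qed
qed

section \<open>From large trees to nonempty derived sets\<close>

lemma finite_grid:
  fixes R d :: real
  assumes "0 < d"
  obtains G where "finite G" "\<And>a. \<bar>a\<bar> \<le> R \<Longrightarrow> \<exists>e\<in>G. a - 2 * d \<le> e \<and> e \<le> a - d"
proof
  \<comment> \<open>The grid consists of multiples of \<open>d\<close>, and the point belonging to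
    \<open>a\<close> is found by rounding \<open>a / d - 1\<close> down. It lies below
    \<open>a\<close> by at least \<open>d\<close>, a margin that later gives strict inequality for
    diameters.\<close>
  let ?G = "(\<lambda>k. d * of_int k) ` {\<lfloor>- R / d - 1\<rfloor>..\<lfloor>R / d - 1\<rfloor>}"
  show "finite ?G" by simp
  fix a assume a: "\<bar>a\<bar> \<le> R"
  let ?k = "\<lfloor>a / d - 1\<rfloor>"
  have "- R / d \<le> a / d" "a / d \<le> R / d"
    using divide_right_mono[of "- R" a d] divide_right_mono[of a R d] a assms by auto
  then have "?k \<in> {\<lfloor>- R / d - 1\<rfloor>..\<lfloor>R / d - 1\<rfloor>}"
    unfolding atLeastAtMost_iff by (intro conjI floor_mono diff_right_mono)
  moreover have "a / d - 2 \<le> of_int ?k" "of_int ?k \<le> a / d - 1" by linarith+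
  then have "d * (a / d - 2) \<le> d * of_int ?k" "d * of_int ?k \<le> d * (a / d - 1)"
    using assms by (simp_all only: mult_le_cancel_left_pos)
  then have "a - 2 * d \<le> d * of_int ?k" "d * of_int ?k \<le> a - d"
    using assms by (simp_all add: right_diff_distrib mult.commute)
  ultimately show "\<exists>e\<in>?G. a - 2 * d \<le> e \<and> e \<le> a - d" by blast
qed

text \<open>This is the pigeonhole principle for filters: finitely many alternatives that each fail
  eventually fail together eventually.\<close>

lemma frequently_bex_finiteD:
  assumes "finite P" "frequently (\<lambda>x. \<exists>p\<in>P. Q p x) F"
  obtains p where "p \<in> P" "frequently (Q p) F"
proof (rule ccontr)
  assume "\<not> thesis"
  then have "\<forall>p\<in>P. eventually (\<lambda>x. \<not> Q p x) F" using that by (auto simp: frequently_def)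
  then have "eventually (\<lambda>x. \<forall>p\<in>P. \<not> Q p x) F" by (rule eventually_ball_finite[OF assms(1)])
  then show False using assms(2) by (simp add: frequently_def)
qed

text \<open>The functional \<open>f\<close> is a weak* cluster point of functionals
  \<open>\<gamma> x\<close> chosen for the \<open>x\<close> in question. Since \<open>f x\<close> is
  eventually small while the real part of \<open>\<gamma> x x\<close> is at least
  \<open>e + d\<close>, there are functionals weak* close to \<open>f\<close> at norm distance more
  than \<open>e\<close> from it.\<close>

lemma szlenk_deriv_step:
  fixes sX :: "'k::real_or_complex_field \<Rightarrow> 'x::real_normed_vector \<Rightarrow> 'x"
    and sY :: "'k \<Rightarrow> 'y::real_normed_vector \<Rightarrow> 'y" and es :: "real list"
  assumes X: "K_normed_space sX" and Y: "K_normed_space sY" and A: "A \<in> operators sX sY" and d: "0 < d"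
  defines "L \<equiv> foldr (szlenk_deriv sX) es (adjoint_image_ball sY A)"
  assumes freq: "frequently (\<lambda>x. norm x \<le> 1 \<and> (\<exists>g\<in>L. c \<le> scalar_Re (blinfun_apply g (y + x)) \<and>
      scalar_Re (g x) - 2 * d \<le> e \<and> e \<le> scalar_Re (g x) - d)) (weakly_null_filter sX)"
  obtains f where "f \<in> szlenk_deriv sX e L" "c - 3 * d \<le> scalar_Re (f y) + e"
proof -
  define Q where "Q = {x. norm x \<le> 1 \<and> (\<exists>g\<in>L. c \<le> scalar_Re (blinfun_apply g (y + x)) \<and>
      scalar_Re (g x) - 2 * d \<le> e \<and> e \<le> scalar_Re (g x) - d)}"
  let ?F = "inf (weakly_null_filter sX) (principal Q)"
  have neq: "?F \<noteq> bot"
    using freq by (simp add: trivial_limit_def eventually_inf_principal frequently_def Q_def)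
  have "\<forall>x\<in>Q. \<exists>g. g \<in> L \<and> c \<le> scalar_Re (blinfun_apply g (y + x)) \<and>
      scalar_Re (g x) - 2 * d \<le> e \<and> e \<le> scalar_Re (g x) - d" by (auto simp: Q_def)
  from bchoice[OF this] obtain \<gamma> where \<gamma>: "\<And>x. x \<in> Q \<Longrightarrow> \<gamma> x \<in> L"
    "\<And>x. x \<in> Q \<Longrightarrow> c \<le> scalar_Re (blinfun_apply (\<gamma> x) (y + x))"
    "\<And>x. x \<in> Q \<Longrightarrow> scalar_Re (\<gamma> x x) - 2 * d \<le> e" "\<And>x. x \<in> Q \<Longrightarrow> e \<le> scalar_Re (\<gamma> x x) - d"
    by auto
  have LK: "L \<subseteq> adjoint_image_ball sY A" unfolding L_def by (rule foldr_szlenk_deriv_subset)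
  then have L: "L \<subseteq> dual sX" "bounded L"
    using adjoint_image_ball_bounds(1,2)[OF X Y A] bounded_subset by blast+
  have "eventually (\<lambda>x. \<gamma> x \<in> adjoint_image_ball sY A) ?F"
    unfolding eventually_inf_principal using \<gamma>(1) LK by (intro always_eventually) auto
  then obtain f where fK: "f \<in> adjoint_image_ball sY A"
    and cluster: "\<And>V. openin (weak_star sX) V \<Longrightarrow> f \<in> V \<Longrightarrow> frequently (\<lambda>x. \<gamma> x \<in> V) ?F"
    using weak_star_cluster_point[OF X Y A neq] by metis
  have f: "f \<in> dual sX" using fK adjoint_image_ball_bounds(1)[OF X Y A] by blast
  have point: "\<exists>x\<in>Q. \<gamma> x \<in> V \<and> norm (blinfun_apply f x) < d / 2" if V: "openin (weak_star sX) V" "f \<in> V" for V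
  proof (rule ccontr)
    assume no: "\<not> ?thesis"
    have "eventually (\<lambda>x. norm (blinfun_apply f x) < d / 2) (weakly_null_filter sX)"
      using d by (intro eventually_weakly_null_dual[OF f]) simp
    then have "eventually (\<lambda>x. \<gamma> x \<notin> V) ?F"
      unfolding eventually_inf_principal by (rule eventually_mono) (use no in blast)
    then show False using cluster[OF V] by (simp add: frequently_def)
  qed
  have "f \<in> weak_star sX closure_of L"
    unfolding in_closure_of topspace_weak_star using f point \<gamma>(1) by blast
  then have fL: "f \<in> L" unfolding L_def using fK by (intro foldr_szlenk_deriv_closed)
  have "e < diameter (V \<inter> L)" if V: "openin (weak_star sX) V" "f \<in> V" for V
  proof -
    obtain x where x: "x \<in> Q" "\<gamma> x \<in> V" "norm (blinfun_apply f x) < d / 2" using point[OF V] by blast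
    have "scalar_Re (\<gamma> x x) - scalar_Re (f x) \<le> norm (blinfun_apply (\<gamma> x - f) x)"
      using scalar_Re_le[of "(\<gamma> x - f) x"] by (simp add: blinfun.diff_left scalar_Re_diff)
    also have "\<dots> \<le> norm (\<gamma> x - f) * norm x" by (rule norm_blinfun)
    also have "\<dots> \<le> dist (\<gamma> x) f" using x(1) by (simp add: Q_def dist_norm mult_left_le)
    also have "\<dots> \<le> diameter (V \<inter> L)"
      using x(2) \<gamma>(1)[OF x(1)] V(2) fL L(2) by (intro diameter_bounded_bound) (auto simp: bounded_Int)
    finally show ?thesis using \<gamma>(4)[OF x(1)] x(3) scalar_Re_le[of "f x"] d by linarith
  qed
  then have "f \<in> szlenk_deriv sX e L" using fL by (simp add: szlenk_deriv_def)
  \<comment> \<open>The loss consists of \<open>d\<close> from replacing \<open>\<gamma> x\<close>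
    by \<open>f\<close> at \<open>y\<close> and \<open>2 * d\<close> from the rounding in the
    grid.\<close>
  moreover have "c - 3 * d \<le> scalar_Re (f y) + e"
  proof -
    obtain x where x: "x \<in> Q" "norm (blinfun_apply (\<gamma> x) y - blinfun_apply f y) < d"
      using point[OF openin_weak_star_basic[of "{y}" sX f d]] f d by auto
    have "scalar_Re (\<gamma> x y) - scalar_Re (f y) < d"
      using x(2) scalar_Re_le[of "\<gamma> x y - f y"] by (simp add: scalar_Re_diff)
    then show ?thesis using \<gamma>(2,3)[OF x(1)] by (simp add: blinfun.add_right scalar_Re_add)
  qed
  ultimately show thesis by (rule that)
qed

text \<open>The induction starts with a norming functional of \<open>A y\<close> and adds one
  derivation for each vector removed. The induction hypothesis gives a list and a functional for
  each \<open>x\<close>; rounding leaves only finitely many candidates \<open>(e, es)\<close>, so a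
  single pair serves frequently many \<open>x\<close>. Each level costs
  \<open>3 * d\<close>.\<close>

lemma not_iterated_bound_imp_szlenk:
  fixes sX :: "'k::real_or_complex_field \<Rightarrow> 'x::real_normed_vector \<Rightarrow> 'x"
    and sY :: "'k \<Rightarrow> 'y::real_normed_vector \<Rightarrow> 'y"
  assumes X: "K_normed_space sX" and Y: "K_normed_space sY" and A: "A \<in> operators sX sY" and d: "0 < d"
    and G: "finite G" "\<And>a. \<bar>a\<bar> \<le> norm A \<Longrightarrow> \<exists>e\<in>G. a - 2 * d \<le> e \<and> e \<le> a - d"
  shows "\<not> iterated_bound sX A n s y \<Longrightarrow>
    \<exists>es f. set es \<subseteq> G \<and> length es = n \<and> f \<in> foldr (szlenk_deriv sX) es (adjoint_image_ball sY A) \<and>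
      s - 3 * real n * d \<le> scalar_Re (f y) + sum_list es"
proof (induction n arbitrary: y)
  case 0
  obtain g where "g \<in> dual sY" "norm g \<le> 1" "scalar_Re (g (A y)) = norm (A y)"
    using norming_functional[OF Y] by blast
  then show ?case using 0
    by (intro exI[of _ "[]"] exI[of _ "g o\<^sub>L A"]) (auto simp: adjoint_image_ball_def)
next
  case (Suc n)
  let ?K = "adjoint_image_ball sY A"
  let ?Q = "\<lambda>(e, es) x. norm x \<le> 1 \<and> (\<exists>g\<in>foldr (szlenk_deriv sX) es ?K.
      s - 3 * real n * d - sum_list es \<le> scalar_Re (g (y + x)) \<and>
      scalar_Re (g x) - 2 * d \<le> e \<and> e \<le> scalar_Re (g x) - d)"
  let ?P = "G \<times> {es. set es \<subseteq> G \<and> length es = n}"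
  have "frequently (\<lambda>x. \<not> iterated_bound sX A n s (y + x)) (weakly_null_filter sX)"
    using Suc.prems by (simp add: frequently_def)
  then have freq: "frequently (\<lambda>x. \<exists>p\<in>?P. ?Q p x) (weakly_null_filter sX)"
  proof (rule frequently_rev_mp)
    show "eventually (\<lambda>x. \<not> iterated_bound sX A n s (y + x) \<longrightarrow> (\<exists>p\<in>?P. ?Q p x)) (weakly_null_filter sX)"
    proof (rule eventually_mono[OF eventually_weakly_null_norm], rule impI)
      fix x assume x: "norm x \<le> 1" "\<not> iterated_bound sX A n s (y + x)"
      from Suc.IH[OF x(2)] obtain es g where es: "set es \<subseteq> G" "length es = n"
        and g: "g \<in> foldr (szlenk_deriv sX) es ?K" "s - 3 * real n * d \<le> scalar_Re (g (y + x)) + sum_list es"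
        by blast
      have "g \<in> ?K" using g(1) foldr_szlenk_deriv_subset by blast
      then have "norm g \<le> norm A" by (rule adjoint_image_ball_bounds(3)[OF X Y A])
      then have "norm g * norm x \<le> norm A * 1" using x(1) by (intro mult_mono) auto
      then have "\<bar>scalar_Re (g x)\<bar> \<le> norm A"
        using abs_scalar_Re_le[of "g x"] norm_blinfun[of g x] by simp
      then obtain e where "e \<in> G" "scalar_Re (g x) - 2 * d \<le> e" "e \<le> scalar_Re (g x) - d"
        using G(2) by blast
      then show "\<exists>p\<in>?P. ?Q p x"
        using x(1) es g by (intro bexI[of _ "(e, es)"]) (auto intro!: bexI[of _ g])
    qed
  qed
  have "finite ?P" using G(1) by (simp add: finite_lists_length_eq)
  then obtain p where p: "p \<in> ?P" "frequently (?Q p) (weakly_null_filter sX)"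
    using freq by (rule frequently_bex_finiteD)
  obtain e es where pe: "p = (e, es)" by fastforce
  obtain f where f: "f \<in> szlenk_deriv sX e (foldr (szlenk_deriv sX) es ?K)"
    "s - 3 * real n * d - sum_list es - 3 * d \<le> scalar_Re (f y) + e"
    using szlenk_deriv_step[OF X Y A d, of es "s - 3 * real n * d - sum_list es" y e] p(2)
    unfolding pe prod.case by metis
  show ?case
  proof (intro exI conjI)
    show "f \<in> foldr (szlenk_deriv sX) (e # es) ?K" using f(1) by simp
    show "s - 3 * real (Suc n) * d \<le> scalar_Re (f y) + sum_list (e # es)"
      using f(2) by (simp add: algebra_simps)
  qed (use p(1) pe in auto)
qed

lemma Sigma_op_le_if_summable_Szlenk_const:
  assumes X: "K_normed_space sX" and Y: "K_normed_space sY" and A: "A \<in> operators sX sY"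
    and M: "0 \<le> M" "summable_Szlenk_const sX M (adjoint_image_ball sY A)"
  shows "Sigma_op sX A \<le> ennreal M"
  unfolding Sigma_op_le_iff[OF M(1)]
proof (intro allI impI)
  fix n s assume s: "M < s"
  show "iterated_bound sX A n s 0"
  proof (cases "n = 0")
    case True
    then show ?thesis using M(1) s by simp
  next
    case False
    \<comment> \<open>The total loss \<open>3 * real n * d\<close> is then half of
      \<open>s - M\<close>.\<close>
    define d where "d = (s - M) / (6 * real n)"
    have d: "0 < d" "3 * real n * d < s - M" using s False by (simp_all add: d_def)
    obtain G where G: "finite G" "\<And>a. \<bar>a\<bar> \<le> norm A \<Longrightarrow> \<exists>e\<in>G. a - 2 * d \<le> e \<and> e \<le> a - d"
      using finite_grid[OF d(1)] by blast
    show ?thesis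
    proof (rule ccontr)
      assume "\<not> iterated_bound sX A n s 0"
      from not_iterated_bound_imp_szlenk[OF X Y A d(1) G this] obtain es f where
        "length es = n" "f \<in> foldr (szlenk_deriv sX) es (adjoint_image_ball sY A)"
        "s - 3 * real n * d \<le> scalar_Re (f 0) + sum_list es" by auto
      moreover from this have "sum_list es \<le> M"
        using M(2) False unfolding summable_Szlenk_const_def by (metis empty_iff list.size(3))
      ultimately show False
        using d(2) scalar_Re_of_real[of 0, where 'k='a] by simp
    qed
  qed
qed

text \<open>The constants differ: an \<open>M\<close>-summable index bounds \<Sigma> by
  \<open>M\<close>, and a bound \<open>S\<close> for \<Sigma> makes the index
  \<open>4 * S\<close>-summable. The ideal properties can then be checked on \<Sigma> alone.\<close>

theorem summable_Szlenk_operators_iff: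
  assumes X: "K_normed_space sX" and Y: "K_normed_space sY"
  shows "A \<in> summable_Szlenk_operators sX sY \<longleftrightarrow> A \<in> operators sX sY \<and> Sigma_op sX A < \<infinity>"
proof (cases "A \<in> operators sX sY")
  case True
  show ?thesis
  proof
    assume "A \<in> summable_Szlenk_operators sX sY"
    then obtain M where "0 \<le> M" "summable_Szlenk_const sX M (adjoint_image_ball sY A)"
      by (auto simp: summable_Szlenk_operators_def summable_Szlenk_def)
    then have "Sigma_op sX A \<le> ennreal M" by (rule Sigma_op_le_if_summable_Szlenk_const[OF assms True])
    also have "\<dots> < \<infinity>" by simp
    finally show "A \<in> operators sX sY \<and> Sigma_op sX A < \<infinity>" using True by simp
  next
    assume "A \<in> operators sX sY \<and> Sigma_op sX A < \<infinity>"
    then obtain S where "0 \<le> S" "Sigma_op sX A = ennreal S" by (auto simp: less_top_ennreal)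
    then show "A \<in> summable_Szlenk_operators sX sY"
      using True summable_Szlenk_const_if_Sigma_op_le[OF assms True, of S]
      by (auto simp: summable_Szlenk_operators_def summable_Szlenk_def intro!: exI[of _ "4 * S"])
  qed
qed (simp add: summable_Szlenk_operators_def)

section \<open>The Banach ideal\<close>

lemma Sigma_op_finiteE:
  assumes "Sigma_op sX A < \<infinity>"
  obtains a where "0 \<le> a" "Sigma_op sX A = ennreal a"
  using assms by (auto simp: less_top_ennreal)

lemma Sigma_op_add_le: "Sigma_op sX (A + B) \<le> Sigma_op sX A + Sigma_op sX B"
proof (cases "Sigma_op sX A < \<infinity> \<and> Sigma_op sX B < \<infinity>")
  case True
  then obtain a b where a: "0 \<le> a" "Sigma_op sX A = ennreal a" and b: "0 \<le> b" "Sigma_op sX B = ennreal b"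
    by (meson Sigma_op_finiteE)
  have "Sigma_op sX (A + B) \<le> ennreal (a + b)"
  proof (subst Sigma_op_le_iff, use a b in simp, intro allI impI)
    fix n s assume s: "a + b < s"
    define h where "h = (s - a - b) / 2"
    have "iterated_bound sX A n (a + h) 0" "iterated_bound sX B n (b + h) 0"
      using Sigma_op_le_iff[OF a(1), of sX A] Sigma_op_le_iff[OF b(1), of sX B] a(2) b(2) s
      by (auto simp: h_def)
    then show "iterated_bound sX (A + B) n s 0"
      by (rule iterated_bound_mono[OF iterated_bound_add]) (simp add: h_def field_simps)
  qed
  then show ?thesis using a b by simp
next
  case False
  then show ?thesis by (auto simp: less_top[symmetric])
qed

lemma Sigma_op_dominated:
  assumes fin: "Sigma_op sX A < \<infinity>" and c: "0 \<le> c"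
    and le: "\<And>y. norm (blinfun_apply B y) \<le> c * norm (blinfun_apply A y)"
  shows "Sigma_op sX B \<le> ennreal c * Sigma_op sX A"
proof -
  obtain a where a: "0 \<le> a" "Sigma_op sX A = ennreal a" using fin by (rule Sigma_op_finiteE)
  have "Sigma_op sX B \<le> ennreal (c * a)"
  proof (subst Sigma_op_le_iff, use a c in simp, intro allI impI)
    fix n s assume s: "c * a < s"
    \<comment> \<open>Dividing by \<open>c + 1\<close> avoids a case distinction at
      \<open>c = 0\<close> and gives \<open>c * h \<le> s - c * a\<close>.\<close>
    define h where "h = (s - c * a) / (c + 1)"
    have h: "0 < h" using s c by (simp add: h_def)
    then have "iterated_bound sX A n (a + h) 0"
      using Sigma_op_le_iff[OF a(1), of sX A] a(2) by auto
    then have "iterated_bound sX B n (c * (a + h)) 0"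
      by (rule iterated_bound_dominated[OF le c])
    moreover have "(c + 1) * h = s - c * a" using c by (simp add: h_def)
    then have "c * (a + h) \<le> s" using h by (simp add: algebra_simps)
    ultimately show "iterated_bound sX B n s 0" by (rule iterated_bound_mono)
  qed
  then show ?thesis using a c by (simp add: ennreal_mult)
qed

lemma norm_blinfun_dominated:
  assumes "0 \<le> c" "\<And>y. norm (blinfun_apply B y) \<le> c * norm (blinfun_apply A y)"
  shows "norm B \<le> c * norm A"
proof (rule norm_blinfun_bound)
  show "norm (B y) \<le> c * norm A * norm y" for y
    using assms(2)[of y] mult_left_mono[OF norm_blinfun[of A y] assms(1)] by (simp add: mult.assoc)
qed (use assms(1) in simp)

lemma szlenk_norm_dominated:
  assumes "Sigma_op sX A < \<infinity>" "0 \<le> c" "\<And>y. norm (blinfun_apply B y) \<le> c * norm (blinfun_apply A y)"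
  shows "szlenk_norm sX B \<le> ennreal c * szlenk_norm sX A"
proof -
  have "ennreal (norm B) \<le> ennreal c * ennreal (norm A)"
    using norm_blinfun_dominated[OF assms(2,3)] assms(2) by (simp add: ennreal_mult[symmetric] ennreal_leI)
  then show ?thesis
    using Sigma_op_dominated[OF assms] by (simp add: szlenk_norm_def distrib_left add_mono)
qed

lemma szlenk_norm_add_le: "szlenk_norm sX (A + B) \<le> szlenk_norm sX A + szlenk_norm sX B"
proof -
  have "ennreal (norm (A + B)) \<le> ennreal (norm A) + ennreal (norm B)"
    using norm_triangle_ineq[of A B] by (simp add: ennreal_plus[symmetric] ennreal_leI del: ennreal_plus)
  from add_mono[OF this Sigma_op_add_le[of sX A B]] show ?thesis
    by (simp add: szlenk_norm_def add_ac)
qed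

lemma szlenk_norm_eq_0_iff:
  assumes "Sigma_op sX A < \<infinity>"
  shows "szlenk_norm sX A = 0 \<longleftrightarrow> A = 0"
proof
  assume "A = 0"
  moreover have "Sigma_op sX (0 :: 'b \<Rightarrow>\<^sub>L 'c) \<le> ennreal 0 * Sigma_op sX A"
    by (rule Sigma_op_dominated[OF assms]) simp_all
  ultimately show "szlenk_norm sX A = 0" by (simp add: szlenk_norm_def)
qed (simp add: szlenk_norm_def)

lemma szlenk_norm_compose:
  assumes "K_normed_space sW" "K_normed_space sX" and C: "C \<in> operators sW sX" "norm C \<le> 1"
    and fin: "Sigma_op sX B < \<infinity>"
  shows "szlenk_norm sW (B o\<^sub>L C) \<le> szlenk_norm sX B" "Sigma_op sW (B o\<^sub>L C) < \<infinity>"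
proof -
  obtain b where b: "0 \<le> b" "Sigma_op sX B = ennreal b" using fin by (rule Sigma_op_finiteE)
  have "Sigma_op sW (B o\<^sub>L C) \<le> ennreal b"
  proof (subst Sigma_op_le_iff[OF b(1)], intro allI impI)
    fix n s assume "b < s"
    then have "iterated_bound sX B n s (C 0)" using Sigma_op_le_iff[OF b(1), of sX B] b(2) by simp
    then show "iterated_bound sW (B o\<^sub>L C) n s 0" by (rule iterated_bound_compose[OF assms(1-4)])
  qed
  moreover have "norm (B o\<^sub>L C) \<le> norm B"
    using norm_blinfun_compose[of B C] mult_left_mono[OF C(2) norm_ge_zero[of B]] by simp
  ultimately show "szlenk_norm sW (B o\<^sub>L C) \<le> szlenk_norm sX B" "Sigma_op sW (B o\<^sub>L C) < \<infinity>"
    using b(2) by (auto simp: szlenk_norm_def intro: add_mono ennreal_leI le_less_trans)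
qed

lemma szlenk_norm_uminus: "szlenk_norm sX (- A) = szlenk_norm sX A"
  by (simp add: szlenk_norm_def Sigma_op_def Sigma_n_def tree_bound_def blinfun.minus_left)

section \<open>Vector space structure, norm and metric for a fixed pair of spaces\<close>

context
  fixes sX :: "'k::real_or_complex_field \<Rightarrow> 'x::real_normed_vector \<Rightarrow> 'x"
    and sY :: "'k \<Rightarrow> 'y::real_normed_vector \<Rightarrow> 'y"
  assumes X: "K_normed_space sX" and Y: "K_normed_space sY"
begin

interpretation X: K_normed_space sX by (rule X)
interpretation Y: K_normed_space sY by (rule Y)

lemma operators_add: "A \<in> operators sX sY \<Longrightarrow> B \<in> operators sX sY \<Longrightarrow> A + B \<in> operators sX sY"
  by (simp add: operators_iff[OF X Y] blinfun.add_left Y.scale_right_distrib)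

lemma operators_op_scale: "A \<in> operators sX sY \<Longrightarrow> op_scale sY c A \<in> operators sX sY"
  by (simp add: operators_iff[OF X Y] Y.op_scale_apply Y.scale_left_commute)

lemma op_scale_of_real: "op_scale sY (of_real r) (A :: 'x \<Rightarrow>\<^sub>L 'y) = r *\<^sub>R A"
  by (rule blinfun_eqI) (simp add: Y.op_scale_apply Y.scale_of_real blinfun.scaleR_left)

lemma operators_scaleR: "A \<in> operators sX sY \<Longrightarrow> r *\<^sub>R A \<in> operators sX sY"
  using operators_op_scale[of A "of_real r"] by (simp add: op_scale_of_real)

lemma operators_diff: "A \<in> operators sX sY \<Longrightarrow> B \<in> operators sX sY \<Longrightarrow> A - B \<in> operators sX sY"
  by (simp add: operators_iff[OF X Y] blinfun.diff_left Y.scale_right_diff_distrib)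

lemma operators_limit:
  assumes "\<And>n. \<sigma> n \<in> operators sX sY" "\<sigma> \<longlonglongrightarrow> A"
  shows "A \<in> operators sX sY"
  unfolding operators_iff[OF X Y]
proof (intro allI)
  fix c x
  have lim: "(\<lambda>n. \<sigma> n z) \<longlonglongrightarrow> A z" for z
    by (rule blinfun.tendsto[OF assms(2) tendsto_const])
  \<comment> \<open>Scalar multiplication by \<open>c\<close> is written as a bounded operator on
    the codomain, which yields its continuity.\<close>
  have "(\<lambda>n. op_scale sY c id_blinfun (\<sigma> n x)) \<longlonglongrightarrow> op_scale sY c id_blinfun (A x)"
    by (rule blinfun.tendsto[OF tendsto_const lim])
  then have "(\<lambda>n. \<sigma> n (sX c x)) \<longlonglongrightarrow> sY c (A x)"
    using assms(1) by (simp add: Y.op_scale_apply operators_iff[OF X Y])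
  then show "A (sX c x) = sY c (A x)" using LIMSEQ_unique lim by blast
qed

lemma module_op_scale: "module (op_scale sY :: 'k \<Rightarrow> ('x \<Rightarrow>\<^sub>L 'y) \<Rightarrow> ('x \<Rightarrow>\<^sub>L 'y))"
  by unfold_locales (auto intro!: blinfun_eqI
      simp: Y.op_scale_apply blinfun.add_left Y.scale_right_distrib Y.scale_left_distrib)

lemma summable_Szlenk_zero: "0 \<in> summable_Szlenk_operators sX sY"
proof -
  have "Sigma_op sX (0 :: 'x \<Rightarrow>\<^sub>L 'y) \<le> ennreal 0"
    by (subst Sigma_op_le_iff) (auto intro: iterated_bound_trivial)
  then have "Sigma_op sX (0 :: 'x \<Rightarrow>\<^sub>L 'y) < \<infinity>" by simp
  then show ?thesis by (simp add: summable_Szlenk_operators_iff[OF X Y] operators_iff[OF X Y] Y.scale_zero_right)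
qed

lemma summable_Szlenk_add: "A \<in> summable_Szlenk_operators sX sY \<Longrightarrow> B \<in> summable_Szlenk_operators sX sY \<Longrightarrow> A + B \<in> summable_Szlenk_operators sX sY"
  using Sigma_op_add_le[of sX A B] by (auto simp: summable_Szlenk_operators_iff[OF X Y] operators_add intro: le_less_trans)

lemma summable_Szlenk_op_scale: "A \<in> summable_Szlenk_operators sX sY \<Longrightarrow> op_scale sY c A \<in> summable_Szlenk_operators sX sY"
  using Sigma_op_dominated[of sX A "norm c" "op_scale sY c A"]
  by (auto simp: summable_Szlenk_operators_iff[OF X Y] operators_op_scale Y.op_scale_apply Y.norm_scale ennreal_mult_less_top
      intro: le_less_trans)

lemma summable_Szlenk_diff: "A \<in> summable_Szlenk_operators sX sY \<Longrightarrow> B \<in> summable_Szlenk_operators sX sY \<Longrightarrow> A - B \<in> summable_Szlenk_operators sX sY"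
proof -
  assume A: "A \<in> summable_Szlenk_operators sX sY" and B: "B \<in> summable_Szlenk_operators sX sY"
  have "op_scale sY (of_real (- 1)) B = - B" by (simp only: op_scale_of_real scaleR_minus_left scaleR_one)
  then have "- B \<in> summable_Szlenk_operators sX sY" using summable_Szlenk_op_scale[OF B] by metis
  from summable_Szlenk_add[OF A this] show ?thesis by simp
qed

lemma szlenk_norm_finite: "A \<in> summable_Szlenk_operators sX sY \<Longrightarrow> szlenk_norm sX A < \<infinity>"
  by (simp add: summable_Szlenk_operators_iff[OF X Y] szlenk_norm_def)

text \<open>The reverse inequality is the first one for \<open>inverse c\<close>, applied to the
  scaled operator.\<close>

lemma szlenk_norm_op_scale:
  assumes "A \<in> summable_Szlenk_operators sX sY"
  shows "szlenk_norm sX (op_scale sY c A) = ennreal (norm c) * szlenk_norm sX A"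
proof (rule antisym)
  have le: "szlenk_norm sX (op_scale sY c A) \<le> ennreal (norm c) * szlenk_norm sX A"
    if "A \<in> summable_Szlenk_operators sX sY" for A c
    using that by (intro szlenk_norm_dominated) (auto simp: summable_Szlenk_operators_iff[OF X Y] Y.op_scale_apply Y.norm_scale)
  show "szlenk_norm sX (op_scale sY c A) \<le> ennreal (norm c) * szlenk_norm sX A"
    by (rule le[OF assms])
  show "ennreal (norm c) * szlenk_norm sX A \<le> szlenk_norm sX (op_scale sY c A)"
  proof (cases "c = 0")
    case False
    have "op_scale sY (inverse c) (op_scale sY c A) = A"
      using False by (intro blinfun_eqI) (simp add: Y.op_scale_apply)
    then have "szlenk_norm sX A \<le> ennreal (norm (inverse c)) * szlenk_norm sX (op_scale sY c A)"
      using le[OF summable_Szlenk_op_scale[OF assms, of c], of "inverse c"] by simp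
    then have "ennreal (norm c) * szlenk_norm sX A
        \<le> ennreal (norm c) * (ennreal (norm (inverse c)) * szlenk_norm sX (op_scale sY c A))"
      by (rule mult_left_mono) simp
    also have "\<dots> = szlenk_norm sX (op_scale sY c A)"
      using False by (simp add: mult.assoc[symmetric] ennreal_mult[symmetric] norm_inverse)
    finally show ?thesis .
  qed simp
qed

text \<open>Weakly null vectors have small images under an operator of rank one, so \<Sigma>
  vanishes and only the operator norm remains.\<close>

lemma szlenk_norm_rank_one:
  assumes f: "f \<in> dual sX"
  shows "szlenk_norm sX (rank_one sY f v) = ennreal (norm f * norm v)" "rank_one sY f v \<in> summable_Szlenk_operators sX sY"
proof -
  let ?R = "rank_one sY f v"
  have "Sigma_op sX ?R \<le> ennreal 0"
    by (subst Sigma_op_le_iff) (auto intro: iterated_bound_rank_one[OF Y f])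
  then have S: "Sigma_op sX ?R = 0" by simp
  have "norm ?R \<le> norm v * norm f"
    by (rule norm_blinfun_dominated) (auto simp: Y.rank_one_apply Y.norm_scale)
  moreover have "norm v * norm f \<le> norm ?R"
  proof (cases "v = 0")
    case False
    have "norm f \<le> (1 / norm v) * norm ?R"
      by (rule norm_blinfun_dominated) (use False in \<open>auto simp: Y.rank_one_apply Y.norm_scale\<close>)
    then show ?thesis using False by (simp add: field_simps)
  qed simp
  ultimately show "szlenk_norm sX ?R = ennreal (norm f * norm v)"
    by (simp add: szlenk_norm_def S mult.commute)
  have "?R \<in> operators sX sY"
    using f by (simp add: operators_iff[OF X Y] dual_iff[OF X] Y.rank_one_apply)
  then show "?R \<in> summable_Szlenk_operators sX sY" by (simp add: summable_Szlenk_operators_iff[OF X Y] S)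
qed

lemma Metric_space_szlenk: "Metric_space (summable_Szlenk_operators sX sY) (\<lambda>A B. enn2real (szlenk_norm sX (A - B)))"
proof
  fix A B C assume A: "A \<in> summable_Szlenk_operators sX sY" and B: "B \<in> summable_Szlenk_operators sX sY"
  note fin = szlenk_norm_finite[OF summable_Szlenk_diff]
  show "enn2real (szlenk_norm sX (A - B)) = 0 \<longleftrightarrow> A = B"
    using fin[OF A B] szlenk_norm_eq_0_iff[of sX "A - B"] summable_Szlenk_diff[OF A B]
    by (auto simp: enn2real_eq_0_iff summable_Szlenk_operators_iff[OF X Y])
  assume C: "C \<in> summable_Szlenk_operators sX sY"
  have "szlenk_norm sX (A - C) \<le> szlenk_norm sX (A - B) + szlenk_norm sX (B - C)"
    using szlenk_norm_add_le[of sX "A - B" "B - C"] by simp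
  from enn2real_mono[OF this] show "enn2real (szlenk_norm sX (A - C))
      \<le> enn2real (szlenk_norm sX (A - B)) + enn2real (szlenk_norm sX (B - C))"
    using fin[OF A B] fin[OF B C] by (simp add: enn2real_plus)
next
  show "enn2real (szlenk_norm sX (A - B)) = enn2real (szlenk_norm sX (B - A))" for A B
    using szlenk_norm_uminus[of sX "A - B"] by simp
qed simp

end

text \<open>Composition from the right was treated for contractions, so \<open>C\<close> is
  normalised; the factors \<open>norm A\<close> and \<open>norm C\<close> are then pulled out by
  domination.\<close>

lemma szlenk_norm_ideal:
  fixes sW :: "'k::real_or_complex_field \<Rightarrow> 'w::real_normed_vector \<Rightarrow> 'w"
    and sX :: "'k \<Rightarrow> 'x::real_normed_vector \<Rightarrow> 'x"
    and sY :: "'k \<Rightarrow> 'y::real_normed_vector \<Rightarrow> 'y"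
    and sZ :: "'k \<Rightarrow> 'z::real_normed_vector \<Rightarrow> 'z"
  assumes W: "K_normed_space sW" and X: "K_normed_space sX" and Y: "K_normed_space sY" and Z: "K_normed_space sZ"
    and C: "C \<in> operators sW sX" and B: "B \<in> summable_Szlenk_operators sX sY" and A: "A \<in> operators sY sZ"
  shows "szlenk_norm sW (A o\<^sub>L B o\<^sub>L C) \<le> ennreal (norm A) * szlenk_norm sX B * ennreal (norm C)"
    and "A o\<^sub>L B o\<^sub>L C \<in> summable_Szlenk_operators sW sZ"
proof -
  \<comment> \<open>If \<open>C = 0\<close> then also \<open>C' = 0\<close>, because
    \<open>inverse 0 = 0\<close>, and the factorisation of \<open>C\<close> still holds.\<close>
  define C' where "C' = inverse (norm C) *\<^sub>R C"
  have C': "C' \<in> operators sW sX" "norm C' \<le> 1" "C = norm C *\<^sub>R C'"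
    using operators_scaleR[OF W X C] by (cases "C = 0"; simp add: C'_def)+
  have finB: "Sigma_op sX B < \<infinity>" using B by (simp add: summable_Szlenk_operators_iff[OF X Y])
  note BC' = szlenk_norm_compose[OF W X C'(1,2) finB]
  have dom: "norm ((A o\<^sub>L B o\<^sub>L C) y) \<le> norm A * norm C * norm ((B o\<^sub>L C') y)" for y
  proof -
    have "(A o\<^sub>L B o\<^sub>L C) y = norm C *\<^sub>R A (B (C' y))"
      by (subst C'(3)) (simp add: blinfun.scaleR_left blinfun.scaleR_right)
    then show ?thesis
      using mult_left_mono[OF norm_blinfun[of A "B (C' y)"] norm_ge_zero[of C]] by (simp add: mult_ac)
  qed
  have "szlenk_norm sW (A o\<^sub>L B o\<^sub>L C) \<le> ennreal (norm A * norm C) * szlenk_norm sW (B o\<^sub>L C')"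
    by (rule szlenk_norm_dominated[OF BC'(2) _ dom]) simp
  also have "\<dots> \<le> ennreal (norm A * norm C) * szlenk_norm sX B"
    by (rule mult_left_mono[OF BC'(1)]) simp
  finally show "szlenk_norm sW (A o\<^sub>L B o\<^sub>L C) \<le> ennreal (norm A) * szlenk_norm sX B * ennreal (norm C)"
    by (simp add: ennreal_mult mult_ac)
  have "Sigma_op sW (A o\<^sub>L B o\<^sub>L C) \<le> ennreal (norm A * norm C) * Sigma_op sW (B o\<^sub>L C')"
    by (rule Sigma_op_dominated[OF BC'(2) _ dom]) simp
  also have "\<dots> < \<infinity>" using BC'(2) by (simp add: ennreal_mult_less_top)
  finally have "Sigma_op sW (A o\<^sub>L B o\<^sub>L C) < \<infinity>" .
  moreover have "A o\<^sub>L B o\<^sub>L C \<in> operators sW sZ"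
    using A B C by (simp add: summable_Szlenk_operators_iff[OF X Y] operators_iff W X Y Z)
  ultimately show "A o\<^sub>L B o\<^sub>L C \<in> summable_Szlenk_operators sW sZ"
    by (simp add: summable_Szlenk_operators_iff[OF W Z])
qed

section \<open>Completeness\<close>

lemma mcomplete_szlenk:
  fixes sX :: "'k::real_or_complex_field \<Rightarrow> 'x::real_normed_vector \<Rightarrow> 'x"
    and sY :: "'k \<Rightarrow> 'y::banach \<Rightarrow> 'y"
  assumes X: "K_normed_space sX" and Y: "K_normed_space sY"
  shows "Metric_space.mcomplete (summable_Szlenk_operators sX sY)
    (\<lambda>A B. enn2real (szlenk_norm sX (A - B)))"
proof -
  let ?J = "summable_Szlenk_operators sX sY"
  let ?d = "\<lambda>A B. enn2real (szlenk_norm sX (A - B))"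
  interpret M: Metric_space ?J ?d by (rule Metric_space_szlenk[OF X Y])
  note J_iff = summable_Szlenk_operators_iff[OF X Y]
  show ?thesis
    unfolding M.mcomplete_def
  proof (intro allI impI)
    fix \<sigma> assume "M.MCauchy \<sigma>"
    then have J: "\<And>n. \<sigma> n \<in> ?J"
      and Cauchy: "\<And>e. 0 < e \<Longrightarrow> \<exists>N. \<forall>n m. N \<le> n \<longrightarrow> N \<le> m \<longrightarrow> ?d (\<sigma> n) (\<sigma> m) < e"
      by (auto simp: M.MCauchy_def)
    have bound: "norm (A - B) \<le> e" "Sigma_op sX (A - B) \<le> ennreal e"
      if "A \<in> ?J" "B \<in> ?J" "?d A B < e" for A B e
    proof -
      have "szlenk_norm sX (A - B) \<noteq> top"
        using szlenk_norm_finite[OF X Y summable_Szlenk_diff[OF X Y that(1,2)]] by auto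
      then have le: "szlenk_norm sX (A - B) \<le> ennreal e"
        by (rule enn2real_le[OF less_imp_le[OF that(3)]])
      have "ennreal (norm (A - B)) \<le> szlenk_norm sX (A - B)" "Sigma_op sX (A - B) \<le> szlenk_norm sX (A - B)"
        by (simp_all add: szlenk_norm_def)
      then have "ennreal (norm (A - B)) \<le> ennreal e" "Sigma_op sX (A - B) \<le> ennreal e"
        using le by (auto intro: order_trans)
      moreover have "0 < e" using that(3) by (auto intro: le_less_trans[OF enn2real_nonneg])
      ultimately show "norm (A - B) \<le> e" "Sigma_op sX (A - B) \<le> ennreal e" by (simp_all add: ennreal_le_iff)
    qed
    \<comment> \<open>The ideal norm dominates the operator norm, so a limit exists in operator
      norm; it is the candidate for the limit in the ideal.\<close>
    have "Cauchy \<sigma>"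
    proof (rule CauchyI)
      fix e :: real assume "0 < e"
      then obtain N where "\<forall>n m. N \<le> n \<longrightarrow> N \<le> m \<longrightarrow> ?d (\<sigma> n) (\<sigma> m) < e / 2"
        using Cauchy[of "e / 2"] by auto
      then have le: "norm (\<sigma> m - \<sigma> n) \<le> e / 2" if "N \<le> m" "N \<le> n" for m n
        using bound(1)[OF J J] that by blast
      have "norm (\<sigma> m - \<sigma> n) < e" if "N \<le> m" "N \<le> n" for m n
        using le[OF that] \<open>0 < e\<close> by simp
      then show "\<exists>M. \<forall>m\<ge>M. \<forall>n\<ge>M. norm (\<sigma> m - \<sigma> n) < e"
        by blast
    qed
    then obtain A where lim: "\<sigma> \<longlonglongrightarrow> A" using Cauchy_convergent convergent_def by blast
    have A: "A \<in> operators sX sY"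
      by (rule operators_limit[OF X Y _ lim]) (use J in \<open>simp add: J_iff\<close>)
    have close: "\<exists>N. \<forall>n\<ge>N. norm (\<sigma> n - A) \<le> e \<and> Sigma_op sX (\<sigma> n - A) \<le> ennreal e" if e: "0 < e" for e
    proof -
      obtain N where N: "\<And>n m. N \<le> n \<Longrightarrow> N \<le> m \<Longrightarrow> ?d (\<sigma> n) (\<sigma> m) < e" using Cauchy[OF e] by blast
      have "norm (\<sigma> n - A) \<le> e" if n: "N \<le> n" for n
      proof (rule LIMSEQ_le_const2)
        show "(\<lambda>m. norm (\<sigma> n - \<sigma> m)) \<longlonglongrightarrow> norm (\<sigma> n - A)" by (intro tendsto_intros lim)
        show "\<exists>N. \<forall>m\<ge>N. norm (\<sigma> n - \<sigma> m) \<le> e" using bound(1)[OF J J N[OF n]] by blast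
      qed
      \<comment> \<open>For fixed length \<open>k\<close> the bound on
        \<open>\<sigma> n - \<sigma> m\<close> passes to the limit: \<open>m\<close> may depend on
        \<open>k\<close>, and is taken so large that \<open>k\<close> vectors contribute at most
        \<open>h\<close> through \<open>\<sigma> m - A\<close>.\<close>
      moreover have "Sigma_op sX (\<sigma> n - A) \<le> ennreal e" if n: "N \<le> n" for n
      proof (subst Sigma_op_le_iff, use e in simp, intro allI impI)
        fix k s assume s: "e < s"
        define h where "h = (s - e) / 2"
        have h: "0 < h" using s by (simp add: h_def)
        then have "0 < h / (real k + 1)" by simp
        then obtain N' where N': "\<And>m. N' \<le> m \<Longrightarrow> norm (\<sigma> m - A) < h / (real k + 1)"
          using LIMSEQ_D[OF lim] by blast
        let ?m = "max N N'"
        have "norm (\<sigma> ?m - A) * (real k + 1) < h"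
          using N'[of ?m] by (simp add: pos_less_divide_eq add_nonneg_pos)
        then have "norm (\<sigma> ?m - A) + real k * norm (\<sigma> ?m - A) < h" by (simp add: algebra_simps)
        then have "real k * norm (\<sigma> ?m - A) \<le> h"
          using norm_ge_zero[of "\<sigma> ?m - A"] by linarith
        then have "iterated_bound sX (\<sigma> ?m - A) k h 0" by (intro iterated_bound_trivial) simp
        moreover have "iterated_bound sX (\<sigma> n - \<sigma> ?m) k (e + h) 0"
          using bound(2)[OF J J N[OF n, of ?m]] e h by (simp add: Sigma_op_le_iff)
        ultimately have "iterated_bound sX ((\<sigma> n - \<sigma> ?m) + (\<sigma> ?m - A)) k (e + h + h) 0"
          by (intro iterated_bound_add)
        then show "iterated_bound sX (\<sigma> n - A) k s 0" by (simp add: h_def)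
      qed
      ultimately show ?thesis by blast
    qed
    have "A \<in> ?J"
    proof -
      obtain N where "Sigma_op sX (\<sigma> N - A) \<le> ennreal 1" using close[of 1] by auto
      then have "\<sigma> N - A \<in> ?J"
        using A J[of N] by (auto simp: J_iff intro: operators_diff[OF X Y] le_less_trans)
      from summable_Szlenk_diff[OF X Y J[of N] this] show ?thesis by simp
    qed
    moreover have "eventually (\<lambda>n. \<sigma> n \<in> ?J \<and> ?d (\<sigma> n) A < e) sequentially" if e: "0 < e" for e
    proof -
      obtain N where N: "\<And>n. N \<le> n \<Longrightarrow> norm (\<sigma> n - A) \<le> e / 3 \<and> Sigma_op sX (\<sigma> n - A) \<le> ennreal (e / 3)"
        using close[of "e / 3"] e by auto
      have "?d (\<sigma> n) A < e" if "N \<le> n" for n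
      proof -
        have "szlenk_norm sX (\<sigma> n - A) \<le> ennreal (e / 3) + ennreal (e / 3)"
          using N[OF that] unfolding szlenk_norm_def by (intro add_mono ennreal_leI) auto
        also have "\<dots> = ennreal (2 * e / 3)"
          using e by (subst ennreal_plus[symmetric]) auto
        finally have "?d (\<sigma> n) A \<le> 2 * e / 3" using e by (intro enn2real_leI) auto
        then show ?thesis using e by simp
      qed
      then show ?thesis using J unfolding eventually_sequentially by blast
    qed
    ultimately show "\<exists>x. limitin M.mtopology \<sigma> x sequentially"
      unfolding M.limitin_metric by blast
  qed
qed

theorem theorem1p5:
  fixes sW :: "'k::real_or_complex_field \<Rightarrow> 'w::banach \<Rightarrow> 'w"
    and sX :: "'k \<Rightarrow> 'x::banach \<Rightarrow> 'x"
    and sY :: "'k \<Rightarrow> 'y::banach \<Rightarrow> 'y"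
    and sZ :: "'k \<Rightarrow> 'z::banach \<Rightarrow> 'z"
  assumes "K_normed_space sW" and "K_normed_space sX"
    and "K_normed_space sY" and "K_normed_space sZ"
  shows "banach_ideal sW sX sY sZ
    (summable_Szlenk_operators sX sY) (summable_Szlenk_operators sW sZ)
    (summable_Szlenk_operators ((*) :: 'k \<Rightarrow> 'k \<Rightarrow> 'k) (*))
    (szlenk_norm sX) (szlenk_norm sW)"
proof -
  note W = assms(1) and X = assms(2) and Y = assms(3) and Z = assms(4)
  note K = K_normed_space_field[where 'k = 'k]
  \<comment> \<open>The identity of the scalar field has rank one, so its membership follows from
    the rank one case.\<close>
  have "(id_blinfun :: 'k \<Rightarrow>\<^sub>L 'k) = rank_one (*) id_blinfun 1"
    by (rule blinfun_eqI) (simp add: K_normed_space.rank_one_apply[OF K])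
  moreover have "(id_blinfun :: 'k \<Rightarrow>\<^sub>L 'k) \<in> dual (*)" by (simp add: dual_iff[OF K])
  ultimately have id: "(id_blinfun :: 'k \<Rightarrow>\<^sub>L 'k) \<in> summable_Szlenk_operators (*) (*)"
    using szlenk_norm_rank_one(2)[OF K K] by metis
  have "operator_ideal sW sX sY sZ (summable_Szlenk_operators sX sY)
      (summable_Szlenk_operators sW sZ) (summable_Szlenk_operators ((*) :: 'k \<Rightarrow> 'k \<Rightarrow> 'k) (*))"
    unfolding operator_ideal_def module.subspace_def[OF module_op_scale[OF X Y]]
    by (intro conjI ballI allI impI szlenk_norm_ideal(2)[OF W X Y Z] id summable_Szlenk_zero[OF X Y]
        summable_Szlenk_add[OF X Y] summable_Szlenk_op_scale[OF X Y])
      (auto simp: summable_Szlenk_operators_def)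
  moreover have "ideal_norm sW sX sY sZ (summable_Szlenk_operators sX sY) (szlenk_norm sX) (szlenk_norm sW)"
    unfolding ideal_norm_def
    by (intro conjI ballI allI szlenk_norm_ideal(1)[OF W X Y Z] szlenk_norm_add_le
        szlenk_norm_finite[OF X Y] szlenk_norm_op_scale[OF X Y] szlenk_norm_rank_one(1)[OF X Y]
        szlenk_norm_eq_0_iff)
      (auto simp: summable_Szlenk_operators_iff[OF X Y])
  ultimately show ?thesis
    unfolding banach_ideal_def using mcomplete_szlenk[OF X Y] by blast
qed

end
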